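(* Let $G = A *_C B$ be an amalgamated free product. Let $w$ be a word on $A, B$ which is reduced and cyclically reduced and such that $|w| > 1$, and let $\overline{w}$ denote the corresponding element of $G$. Suppose that the double coset $C\overline{w}C$ does not contain the element of $G$ corresponding to any cyclic conjugate of $w^{-1}$. Then there exists a homogeneous quasimorphism $h$ on $G$ such that $h(\overline{w}) = 1$ and the defect of $h$ is $\le 312$.
   Context: A word on $A,B$ is a finite sequence $w = x_1 x_2 \cdots x_k$ of letters $x_i \in A \cup B$, and $|w| = k$ is its length. A word with $|w| > 1$ is reduced (in $A *_C B$) if its letters lie alternately in $A \setminus C$ and $B \setminus C$. A word $w$ is said to be cyclically reduced if $w$ is not equal to $v_1 v_2 v_1^{-1}$ (with $v_1 \ne \emptyset$) as a word. The inverse word of $w = x_1\cdots x_k$ is $w^{-1} = x_k^{-1} \cdots x_1^{-1}$, and a cyclic conjugate of a word $y_1 \cdots y_k$ is any cyclic permutation $y_{j} y_{j+1}\cdots y_k y_1 \cdots y_{j-1}$ (including the word itself). A quasimorphism on $G$ is a function $\phi : G \to \mathbb{R}$ for which there is a least constant $D(\phi) \ge 0$, called the defect, such that $|\phi(x) + \phi(y) - \phi(xy)| \le D(\phi)$ for all $x,y \in G$. It is homogeneous if $\phi(x^n) = n\phi(x)$ for all $x \in G$ and all integers $n$.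
   Formalization: "Cyclically reduced" also requires all cyclic conjugates of w to be reduced (so |w| is even). Otherwise the claim fails: A = Z/2×Z/2 = {1,a,x,ax}, B = Z/2 = ⟨b⟩, C = 1, w = a·b·(xa) is conjugate to its inverse. *)

theory Defs
  imports Complex_Main "HOL-Algebra.Coset"
begin

section \<open>Quasimorphisms\<close>

definition defect_bound :: "('g, 'm) monoid_scheme \<Rightarrow> ('g \<Rightarrow> real) \<Rightarrow> real \<Rightarrow> bool" where
  "defect_bound G \<phi> D \<longleftrightarrow> 0 \<le> D \<and>
     (\<forall>x \<in> carrier G. \<forall>y \<in> carrier G. \<bar>\<phi> x + \<phi> y - \<phi> (x \<otimes>\<^bsub>G\<^esub> y)\<bar> \<le> D)"

definition quasimorphism :: "('g, 'm) monoid_scheme \<Rightarrow> ('g \<Rightarrow> real) \<Rightarrow> bool" where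
  "quasimorphism G \<phi> \<longleftrightarrow> (\<exists>D. defect_bound G \<phi> D)"

text \<open>Only meaningful for quasimorphisms; the lemmas \<open>defect_bound_defect\<close> and \<open>defect_least\<close>
  show that it is then the least bound.\<close>

definition defect :: "('g, 'm) monoid_scheme \<Rightarrow> ('g \<Rightarrow> real) \<Rightarrow> real" where
  "defect G \<phi> = Inf {D. defect_bound G \<phi> D}"

definition homogeneous :: "('g, 'm) monoid_scheme \<Rightarrow> ('g \<Rightarrow> real) \<Rightarrow> bool" where
  "homogeneous G \<phi> \<longleftrightarrow> (\<forall>x \<in> carrier G. \<forall>n :: int. \<phi> (x [^]\<^bsub>G\<^esub> n) = of_int n * \<phi> x)"

lemma defect_least:
  assumes "defect_bound G \<phi> D"
  shows "defect G \<phi> \<le> D"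
  unfolding defect_def using assms
  by (intro cInf_lower bdd_belowI[of _ 0]) (auto simp: defect_bound_def)

lemma defect_bound_defect:
  assumes "quasimorphism G \<phi>"
  shows "defect_bound G \<phi> (defect G \<phi>)"
proof -
  have greatest: "c \<le> defect G \<phi>" if "\<And>D. defect_bound G \<phi> D \<Longrightarrow> c \<le> D" for c
    unfolding defect_def using assms that by (intro cInf_greatest) (auto simp: quasimorphism_def)
  show ?thesis
    unfolding defect_bound_def
    by (intro conjI ballI greatest) (auto simp: defect_bound_def)
qed


section \<open>Words and the amalgamated free product\<close>

text \<open>
  The data are groups \<open>A\<close>, \<open>B\<close>, \<open>C\<close> with monomorphisms \<open>i\<close> from \<open>C\<close> to \<open>A\<close> and \<open>j\<close> from \<open>C\<close> to
  \<open>B\<close>. A word is a list over the disjoint union of \<open>A\<close> and \<open>B\<close>. The two copies \<open>Inl (i c)\<close> and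
  \<open>Inr (j c)\<close> of an element of \<open>C\<close> are distinct letters, but are identified in the group; reduced
  words of length greater than one do not contain such letters.
\<close>

definition words :: "('a, 'm) monoid_scheme \<Rightarrow> ('b, 'n) monoid_scheme \<Rightarrow> ('a + 'b) list set" where
  "words A B = lists (carrier A <+> carrier B)"

text \<open>The congruence on words presenting \<open>A *\<^sub>C B\<close>.\<close>

inductive amalg_equiv ::
  "('a, 'm) monoid_scheme \<Rightarrow> ('b, 'n) monoid_scheme \<Rightarrow> ('c, 'k) monoid_scheme \<Rightarrow>
   ('c \<Rightarrow> 'a) \<Rightarrow> ('c \<Rightarrow> 'b) \<Rightarrow> ('a + 'b) list \<Rightarrow> ('a + 'b) list \<Rightarrow> bool"
  for A B C i j
where
  refl: "u \<in> words A B \<Longrightarrow> amalg_equiv A B C i j u u"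
| sym: "amalg_equiv A B C i j u v \<Longrightarrow> amalg_equiv A B C i j v u"
| trans: "amalg_equiv A B C i j u v \<Longrightarrow> amalg_equiv A B C i j v w \<Longrightarrow> amalg_equiv A B C i j u w"
| append: "amalg_equiv A B C i j u u' \<Longrightarrow> amalg_equiv A B C i j v v' \<Longrightarrow>
    amalg_equiv A B C i j (u @ v) (u' @ v')"
| mult_left: "x \<in> carrier A \<Longrightarrow> y \<in> carrier A \<Longrightarrow>
    amalg_equiv A B C i j [Inl x, Inl y] [Inl (x \<otimes>\<^bsub>A\<^esub> y)]"
| mult_right: "x \<in> carrier B \<Longrightarrow> y \<in> carrier B \<Longrightarrow>
    amalg_equiv A B C i j [Inr x, Inr y] [Inr (x \<otimes>\<^bsub>B\<^esub> y)]"
| one_left: "amalg_equiv A B C i j [Inl \<one>\<^bsub>A\<^esub>] []"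
| one_right: "amalg_equiv A B C i j [Inr \<one>\<^bsub>B\<^esub>] []"
| glue: "c \<in> carrier C \<Longrightarrow> amalg_equiv A B C i j [Inl (i c)] [Inr (j c)]"

definition word_elem ::
  "('a, 'm) monoid_scheme \<Rightarrow> ('b, 'n) monoid_scheme \<Rightarrow> ('c, 'k) monoid_scheme \<Rightarrow>
   ('c \<Rightarrow> 'a) \<Rightarrow> ('c \<Rightarrow> 'b) \<Rightarrow> ('a + 'b) list \<Rightarrow> ('a + 'b) list set" where
  "word_elem A B C i j w = {u. amalg_equiv A B C i j w u}"

definition amalg ::
  "('a, 'm) monoid_scheme \<Rightarrow> ('b, 'n) monoid_scheme \<Rightarrow> ('c, 'k) monoid_scheme \<Rightarrow>
   ('c \<Rightarrow> 'a) \<Rightarrow> ('c \<Rightarrow> 'b) \<Rightarrow> ('a + 'b) list set monoid" where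
  "amalg A B C i j =
    \<lparr>carrier = word_elem A B C i j ` words A B,
     mult = (\<lambda>X Y. \<Union>u\<in>X. \<Union>v\<in>Y. word_elem A B C i j (u @ v)),
     one = word_elem A B C i j []\<rparr>"

definition amalg_base ::
  "('a, 'm) monoid_scheme \<Rightarrow> ('b, 'n) monoid_scheme \<Rightarrow> ('c, 'k) monoid_scheme \<Rightarrow>
   ('c \<Rightarrow> 'a) \<Rightarrow> ('c \<Rightarrow> 'b) \<Rightarrow> ('a + 'b) list set set" where
  "amalg_base A B C i j = (\<lambda>c. word_elem A B C i j [Inl (i c)]) ` carrier C"

definition double_coset :: "('g, 'm) monoid_scheme \<Rightarrow> 'g set \<Rightarrow> 'g \<Rightarrow> 'g set" where
  "double_coset G H x = {c \<otimes>\<^bsub>G\<^esub> x \<otimes>\<^bsub>G\<^esub> c' | c c'. c \<in> H \<and> c' \<in> H}"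

definition inverse_word ::
  "('a, 'm) monoid_scheme \<Rightarrow> ('b, 'n) monoid_scheme \<Rightarrow> ('a + 'b) list \<Rightarrow> ('a + 'b) list" where
  "inverse_word A B w = rev (map (map_sum (m_inv A) (m_inv B)) w)"

definition cyclic_conjugates :: "'x list \<Rightarrow> 'x list set" where
  "cyclic_conjugates w = {rotate n w | n. True}"

text \<open>Used only for words of length greater than one.\<close>

definition reduced_word ::
  "('a, 'm) monoid_scheme \<Rightarrow> ('b, 'n) monoid_scheme \<Rightarrow> ('c, 'k) monoid_scheme \<Rightarrow>
   ('c \<Rightarrow> 'a) \<Rightarrow> ('c \<Rightarrow> 'b) \<Rightarrow> ('a + 'b) list \<Rightarrow> bool" where
  "reduced_word A B C i j w \<longleftrightarrow>
     set w \<subseteq> (carrier A - i ` carrier C) <+> (carrier B - j ` carrier C) \<and>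
     successively (\<lambda>x y. isl x \<noteq> isl y) w"

text \<open>
  The second conjunct says that \<open>w\<close> is not \<open>v\<^sub>1 v\<^sub>2 v\<^sub>1\<inverse>\<close> as a word. This alone would
  admit reduced words such as \<open>a b (x a\<inverse>)\<close> with \<open>a\<close>, \<open>x\<close> in \<open>A\<close>, \<open>b\<close> in \<open>B\<close> and \<open>x \<noteq> 1\<close>, which
  are conjugate to shorter words and on which every homogeneous quasimorphism can vanish.
  The first conjunct is the standard condition for amalgamated products, which rules
  these out: all cyclic conjugates are reduced.
\<close>

definition cyclically_reduced ::
  "('a, 'm) monoid_scheme \<Rightarrow> ('b, 'n) monoid_scheme \<Rightarrow> ('c, 'k) monoid_scheme \<Rightarrow>
   ('c \<Rightarrow> 'a) \<Rightarrow> ('c \<Rightarrow> 'b) \<Rightarrow> ('a + 'b) list \<Rightarrow> bool" where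
  "cyclically_reduced A B C i j w \<longleftrightarrow>
     (\<forall>u \<in> cyclic_conjugates w. reduced_word A B C i j u) \<and>
     \<not> (\<exists>v1 \<in> words A B. \<exists>v2 \<in> words A B. v1 \<noteq> [] \<and> w = v1 @ v2 @ inverse_word A B v1)"


section \<open>The amalgamated free product is a group\<close>

lemma words_simps [simp]:
  "[] \<in> words A B"
  "Inl x # u \<in> words A B \<longleftrightarrow> x \<in> carrier A \<and> u \<in> words A B"
  "Inr y # u \<in> words A B \<longleftrightarrow> y \<in> carrier B \<and> u \<in> words A B"
  "u @ v \<in> words A B \<longleftrightarrow> u \<in> words A B \<and> v \<in> words A B"
  by (auto simp: words_def)

locale amalgamation =
  A: group A + B: group B + C: group C
  for A :: "('a, 'm) monoid_scheme" and B :: "('b, 'n) monoid_scheme"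
    and C :: "('c, 'k) monoid_scheme" +
  fixes i :: "'c \<Rightarrow> 'a" and j :: "'c \<Rightarrow> 'b"
  assumes i_mon: "i \<in> mon C A" and j_mon: "j \<in> mon C B"
begin

abbreviation equiv (infix "\<approx>" 50) where "u \<approx> v \<equiv> amalg_equiv A B C i j u v"
abbreviation elem where "elem \<equiv> word_elem A B C i j"
abbreviation G where "G \<equiv> amalg A B C i j"

lemma i_closed [simp]: "c \<in> carrier C \<Longrightarrow> i c \<in> carrier A"
  and j_closed [simp]: "c \<in> carrier C \<Longrightarrow> j c \<in> carrier B"
  using i_mon j_mon by (auto simp: mon_def hom_def)

lemma equiv_words: "u \<approx> v \<Longrightarrow> u \<in> words A B \<and> v \<in> words A B"
  by (induction rule: amalg_equiv.induct) auto

lemma elem_eq_iff: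
  assumes "u \<in> words A B"
  shows "elem u = elem v \<longleftrightarrow> u \<approx> v"
proof
  assume "elem u = elem v"
  moreover have "u \<in> elem u"
    using assms by (simp add: word_elem_def amalg_equiv.refl)
  ultimately have "v \<approx> u"
    by (simp add: word_elem_def)
  then show "u \<approx> v"
    by (rule amalg_equiv.sym)
next
  assume uv: "u \<approx> v"
  have "u \<approx> z \<longleftrightarrow> v \<approx> z" for z
    using amalg_equiv.trans[OF uv, of z] amalg_equiv.trans[OF amalg_equiv.sym[OF uv], of z] by blast
  then show "elem u = elem v"
    by (simp add: word_elem_def)
qed

lemma mult_elem:
  assumes "u \<in> words A B" "v \<in> words A B"
  shows "elem u \<otimes>\<^bsub>G\<^esub> elem v = elem (u @ v)"
proof -
  have "elem (u' @ v') = elem (u @ v)" if "u' \<in> elem u" "v' \<in> elem v" for u' v'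
    using that assms elem_eq_iff[of "u @ v" "u' @ v'"]
    by (simp add: word_elem_def amalg_equiv.append)
  moreover have "u \<in> elem u" "v \<in> elem v"
    using assms by (simp_all add: word_elem_def amalg_equiv.refl)
  ultimately have "(\<Union>u'\<in>elem u. \<Union>v'\<in>elem v. elem (u' @ v')) = elem (u @ v)"
    by blast
  then show ?thesis
    by (simp add: amalg_def)
qed

lemma inverse_word_closed: "u \<in> words A B \<Longrightarrow> inverse_word A B u \<in> words A B"
  by (induction u) (auto simp: words_def inverse_word_def)

lemma inverse_letter_cancel:
  assumes "s \<in> carrier A <+> carrier B"
  shows "[map_sum (m_inv A) (m_inv B) s, s] \<approx> []"
proof (cases s)
  case (Inl x)
  with assms have x: "x \<in> carrier A" by auto
  then have "[Inl (inv\<^bsub>A\<^esub> x), Inl x] \<approx> [Inl \<one>\<^bsub>A\<^esub>]"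
    using amalg_equiv.mult_left[of "inv\<^bsub>A\<^esub> x" A x B C i j] by simp
  from amalg_equiv.trans[OF this amalg_equiv.one_left] show ?thesis
    by (simp add: Inl)
next
  case (Inr x)
  with assms have x: "x \<in> carrier B" by auto
  then have "[Inr (inv\<^bsub>B\<^esub> x), Inr x] \<approx> [Inr \<one>\<^bsub>B\<^esub>]"
    using amalg_equiv.mult_right[of "inv\<^bsub>B\<^esub> x" B x A C i j] by simp
  from amalg_equiv.trans[OF this amalg_equiv.one_right] show ?thesis
    by (simp add: Inr)
qed

lemma inverse_word_cancel: "u \<in> words A B \<Longrightarrow> inverse_word A B u @ u \<approx> []"
proof (induction u)
  case Nil
  show ?case by (simp add: inverse_word_def amalg_equiv.refl)
next
  case (Cons s u)
  let ?s = "map_sum (m_inv A) (m_inv B) s"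
  have u: "u \<in> words A B" and s: "s \<in> carrier A <+> carrier B"
    using Cons.prems by (auto simp: words_def)
  have "inverse_word A B u @ ([?s, s] @ u) \<approx> inverse_word A B u @ ([] @ u)"
    by (rule amalg_equiv.append[OF amalg_equiv.refl[OF inverse_word_closed[OF u]]
          amalg_equiv.append[OF inverse_letter_cancel[OF s] amalg_equiv.refl[OF u]]])
  from amalg_equiv.trans[OF this] Cons.IH[OF u] show ?case
    by (simp add: inverse_word_def)
qed

lemma carrier_G: "carrier G = elem ` words A B"
  and one_G: "\<one>\<^bsub>G\<^esub> = elem []"
  by (simp_all add: amalg_def)

lemma group_G: "group G"
proof (rule groupI)
  fix X Y
  assume "X \<in> carrier G" "Y \<in> carrier G"
  then obtain u v where "u \<in> words A B" "v \<in> words A B" "X = elem u" "Y = elem v"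
    unfolding carrier_G by blast
  then show "X \<otimes>\<^bsub>G\<^esub> Y \<in> carrier G"
    by (simp add: mult_elem carrier_G)
next
  fix X Y Z
  assume "X \<in> carrier G" "Y \<in> carrier G" "Z \<in> carrier G"
  then obtain u v w where "u \<in> words A B" "v \<in> words A B" "w \<in> words A B"
    "X = elem u" "Y = elem v" "Z = elem w"
    unfolding carrier_G by blast
  then show "X \<otimes>\<^bsub>G\<^esub> Y \<otimes>\<^bsub>G\<^esub> Z = X \<otimes>\<^bsub>G\<^esub> (Y \<otimes>\<^bsub>G\<^esub> Z)"
    by (simp add: mult_elem)
next
  show "\<one>\<^bsub>G\<^esub> \<in> carrier G"
    by (simp add: one_G carrier_G)
next
  fix X
  assume "X \<in> carrier G"
  then obtain u where u: "u \<in> words A B" "X = elem u"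
    unfolding carrier_G by blast
  then show "\<one>\<^bsub>G\<^esub> \<otimes>\<^bsub>G\<^esub> X = X"
    by (simp add: one_G mult_elem)
  have "elem (inverse_word A B u @ u) = elem []"
    using elem_eq_iff[of "inverse_word A B u @ u" "[]"] inverse_word_cancel[of u]
      inverse_word_closed[of u] u by simp
  then have "elem (inverse_word A B u) \<otimes>\<^bsub>G\<^esub> X = \<one>\<^bsub>G\<^esub>"
    using u by (simp add: one_G mult_elem inverse_word_closed)
  moreover have "elem (inverse_word A B u) \<in> carrier G"
    using inverse_word_closed[OF u(1)] by (simp add: carrier_G)
  ultimately show "\<exists>Y \<in> carrier G. Y \<otimes>\<^bsub>G\<^esub> X = \<one>\<^bsub>G\<^esub>" by blast
qed

end

end

theory Submission
  imports Defs
begin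

text \<open>
  The quasimorphism is a homogenized counting quasimorphism. Write \<open>c\<^sub>w(g)\<close> for the largest
  number of pairwise disjoint copies of \<open>w\<close> in a reduced word for \<open>g\<close>, where a segment counts as a
  copy if it has the length of \<open>w\<close> and its product lies in the double coset \<open>C w C\<close>. By the normal
  form theorem (\<open>reduced_word_not_base\<close>), two reduced words for the same element differ only by
  moving elements of \<open>C\<close> between neighbouring letters, so aligned segments span the same double
  coset (\<open>coset_equiv_split\<close>) and \<open>c\<^sub>w\<close> is well defined on \<open>G\<close>.

  Counting disjoint copies makes the defect independent of the length of \<open>w\<close>. Cutting a list at one
  letter destroys at most one of a family of disjoint segments (\<open>copies_cut\<close>), so
  \<open>\<phi> = c\<^sub>w - c\<^sub>w\<^sub>\<inverse>\<close> changes by at most \<open>1\<close>. For \<open>x, y\<close> in \<open>G\<close>,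
  reduced words for \<open>x\<inverse>\<close> and \<open>y\<close> have a longest common initial part \<open>z\<close> (\<open>tripod\<close>),
  and after it they diverge into \<open>p\<close> and \<open>q\<close>. Then \<open>x\<close>, \<open>y\<close> and \<open>x y\<close> have reduced words that are,
  up to at most one letter in the middle, \<open>p\<inverse> z\<inverse>\<close>, \<open>z q\<close> and \<open>p\<inverse> q\<close>. Since
  \<open>\<phi>(z\<inverse>) = - \<phi>(z)\<close>, the contributions of \<open>p\<close>, \<open>q\<close> and \<open>z\<close> cancel and only three errors
  of size \<open>1\<close> remain: \<open>\<phi>\<close> has defect at most \<open>3\<close> (\<open>counting_qm_defect\<close>). Its homogenization \<open>h\<close> is at
  distance at most \<open>3\<close> from \<open>\<phi>\<close>, hence has defect at most \<open>3 + 3 \<cdot> 3 = 12\<close>.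

  As \<open>w\<close> is cyclically reduced, the concatenation of \<open>m\<close> copies of \<open>w\<close> is a reduced word. It has
  room for exactly \<open>m\<close> disjoint copies of \<open>w\<close>. Its segments of length \<open>|w|\<close> are cyclic conjugates
  of \<open>w\<close>; one of them in \<open>C w\<inverse> C\<close> would, after inversion, be a cyclic conjugate of
  \<open>w\<inverse>\<close> in \<open>C w C\<close>, which the hypothesis excludes. So \<open>\<phi>(w\<^sup>m) = m\<close>, and \<open>h(w) = 1\<close>.

  The normal form theorem is proved by van der Waerden's method: \<open>A\<close> and \<open>B\<close> act on the set of normal
  forms, the two actions agree on \<open>C\<close>, and a reduced word moves the empty normal form to one of the
  same length. All the rest of the argument takes place in a group with two subgroups that generate
  it and satisfy the conclusion of that theorem.
\<close>


section \<open>Homogenization\<close>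

lemma quasi_additive_multiple:
  fixes a :: "nat \<Rightarrow> real"
  assumes "\<And>m n. \<bar>a m + a n - a (m + n)\<bar> \<le> D"
  shows "\<bar>a (Suc m * n) - real (Suc m) * a n\<bar> \<le> real m * D"
proof (induction m)
  case 0
  then show ?case by simp
next
  case (Suc m)
  have "\<bar>a n + a (Suc m * n) - a (Suc (Suc m) * n)\<bar> \<le> D"
    using assms[of n "Suc m * n"] by simp
  with Suc show ?case
    by (simp add: algebra_simps)
qed

text \<open>
  Applied to \<open>m n\<close> in both ways, the preceding bound gives
  \<open>(a(m) - D) / m \<le> (a(n) + D) / n\<close> for all positive \<open>m\<close> and \<open>n\<close>. Hence the infimum of the right-hand
  sides separates the two families, and no limit is needed to find the slope.
\<close>

lemma quasi_additive_slope_nat: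
  fixes a :: "nat \<Rightarrow> real"
  assumes a: "\<And>m n. \<bar>a m + a n - a (m + n)\<bar> \<le> D"
  shows "\<exists>r. \<forall>n. \<bar>a n - real n * r\<bar> \<le> D"
proof -
  have D: "0 \<le> D" using a[of 0 0] by linarith
  define U where "U = (\<lambda>n. (a (Suc n) + D) / real (Suc n)) ` UNIV"
  have le: "(a (Suc m) - D) / real (Suc m) \<le> (a (Suc n) + D) / real (Suc n)" for m n
  proof -
    have "\<bar>a (Suc m * Suc n) - real (Suc m) * a (Suc n)\<bar> \<le> real m * D"
      by (rule quasi_additive_multiple[OF a])
    moreover have "\<bar>a (Suc n * Suc m) - real (Suc n) * a (Suc m)\<bar> \<le> real n * D"
      by (rule quasi_additive_multiple[OF a])
    ultimately have "real (Suc n) * (a (Suc m) - D) \<le> real (Suc m) * (a (Suc n) + D)"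
      using D by (simp add: algebra_simps abs_le_iff)
    then show ?thesis
      by (simp add: divide_simps mult.commute del: of_nat_Suc)
  qed
  have lower: "(a (Suc m) - D) / real (Suc m) \<le> Inf U" for m
    unfolding U_def by (rule cINF_greatest) (use le in auto)
  have upper: "Inf U \<le> (a (Suc n) + D) / real (Suc n)" for n
    unfolding U_def by (rule cINF_lower) (use le[of 0] in \<open>auto intro!: bdd_belowI\<close>)
  have "\<bar>a n - real n * Inf U\<bar> \<le> D" for n
  proof (cases n)
    case 0
    then show ?thesis using a[of 0 0] by simp
  next
    case (Suc m)
    show ?thesis
      using lower[of m] upper[of m] unfolding Suc
      by (simp add: divide_simps abs_le_iff mult.commute del: of_nat_Suc)
  qed
  then show ?thesis by blast
qed

text \<open>
  The bound over all integers only serves to identify slopes by their boundedness; its constant is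
  worse because the negative half is reached through \<open>a(n) + a(-n)\<close> and \<open>a(0)\<close>.
\<close>

lemma quasi_additive_slope:
  fixes a :: "int \<Rightarrow> real"
  assumes a: "\<And>m n. \<bar>a m + a n - a (m + n)\<bar> \<le> D"
  shows "\<exists>r. (\<forall>n. \<bar>a (int n) - real n * r\<bar> \<le> D) \<and> (\<forall>n. \<bar>a n - of_int n * r\<bar> \<le> 3 * D)"
proof -
  have D: "0 \<le> D" using a[of 0 0] by linarith
  obtain r where r: "\<And>n. \<bar>a (int n) - real n * r\<bar> \<le> D"
    using quasi_additive_slope_nat[of "\<lambda>n. a (int n)" D] a by (auto simp: of_nat_add)
  have "\<bar>a n - of_int n * r\<bar> \<le> 3 * D" for n
  proof (cases "0 \<le> n")
    case True
    then show ?thesis using r[of "nat n"] D by simp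
  next
    case False
    then show ?thesis
      using r[of "nat (- n)"] a[of n "- n"] a[of 0 0] by simp
  qed
  with r show ?thesis by blast
qed

lemma multiples_bounded_imp_zero:
  fixes t K :: real
  assumes "\<And>n. real n * \<bar>t\<bar> \<le> K"
  shows "t = 0"
  using assms reals_Archimedean3[of "\<bar>t\<bar>"] by (metis abs_ge_zero abs_le_zero_iff linorder_not_le)

text \<open>
  \<open>h(x)\<close> is the slope of \<open>n \<mapsto> \<phi>(x\<^sup>n)\<close>. It is determined by being at bounded distance from this
  sequence, which makes \<open>h\<close> homogeneous: \<open>k h(x)\<close> is a slope for \<open>x\<^sup>k\<close>.
\<close>

lemma (in group) homogenization:
  fixes \<phi> :: "'a \<Rightarrow> real"
  assumes \<phi>: "defect_bound G \<phi> D"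
  obtains h where "homogeneous G h" and "defect_bound G h (4 * D)"
    and "\<And>x. x \<in> carrier G \<Longrightarrow> \<bar>\<phi> x - h x\<bar> \<le> D"
proof -
  define slope where "slope x r \<longleftrightarrow> (\<forall>n. \<bar>\<phi> (x [^] int n) - real n * r\<bar> \<le> D) \<and>
    (\<forall>n::int. \<bar>\<phi> (x [^] n) - of_int n * r\<bar> \<le> 3 * D)" for x r
  define h where "h x = (SOME r. slope x r)" for x
  have h: "slope x (h x)" if x: "x \<in> carrier G" for x
  proof -
    have "\<bar>\<phi> (x [^] m) + \<phi> (x [^] n) - \<phi> (x [^] (m + n))\<bar> \<le> D" for m n :: int
      using \<phi> x by (simp add: defect_bound_def int_pow_mult)
    from quasi_additive_slope[of "\<lambda>n. \<phi> (x [^] n)", OF this]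
    have "\<exists>r. slope x r" by (simp add: slope_def)
    then show ?thesis unfolding h_def by (rule someI_ex)
  qed
  have close: "\<bar>\<phi> x - h x\<bar> \<le> D" if x: "x \<in> carrier G" for x
  proof -
    have "\<bar>\<phi> (x [^] int 1) - real 1 * h x\<bar> \<le> D"
      using h[OF x] unfolding slope_def by blast
    then show ?thesis using x by (simp add: int_pow_1)
  qed
  have "h (x [^] k) = of_int k * h x" if x: "x \<in> carrier G" for x and k :: int
  proof -
    have "real n * \<bar>h (x [^] k) - of_int k * h x\<bar> \<le> 6 * D" for n
    proof -
      have 1: "\<bar>\<phi> (x [^] (k * int n)) - of_int (k * int n) * h x\<bar> \<le> 3 * D"
        using h[OF x] unfolding slope_def by blast
      have "\<bar>\<phi> ((x [^] k) [^] int n) - of_int (int n) * h (x [^] k)\<bar> \<le> 3 * D"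
        using h[of "x [^] k"] x unfolding slope_def by blast
      then have 2: "\<bar>\<phi> (x [^] (k * int n)) - real n * h (x [^] k)\<bar> \<le> 3 * D"
        using x by (simp add: int_pow_pow mult.commute)
      have "real n * \<bar>h (x [^] k) - of_int k * h x\<bar> =
          \<bar>real n * h (x [^] k) - of_int (k * int n) * h x\<bar>"
        by (simp add: abs_mult[symmetric, of "real n", simplified] algebra_simps flip: abs_mult_pos')
      with 1 2 show ?thesis by linarith
    qed
    from multiples_bounded_imp_zero[OF this] show ?thesis by simp
  qed
  then have hom: "homogeneous G h" by (simp add: homogeneous_def)
  have "\<bar>h x + h y - h (x \<otimes> y)\<bar> \<le> 4 * D" if "x \<in> carrier G" "y \<in> carrier G" for x y
  proof -
    have "\<bar>\<phi> x + \<phi> y - \<phi> (x \<otimes> y)\<bar> \<le> D"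
      using \<phi> that by (simp add: defect_bound_def)
    with close[OF that(1)] close[OF that(2)] close[OF m_closed[OF that]] show ?thesis
      by linarith
  qed
  then have "defect_bound G h (4 * D)"
    using \<phi> by (simp add: defect_bound_def)
  with hom close show ?thesis by (intro that)
qed


section \<open>Disjoint copies in a list\<close>

text \<open>
  The list contains \<open>k\<close> pairwise disjoint segments that satisfy \<open>P\<close>, not necessarily the largest
  such number. The clauses read the segments from left to right.
\<close>

inductive packs :: "('x list \<Rightarrow> bool) \<Rightarrow> 'x list \<Rightarrow> nat \<Rightarrow> bool" for P where
  none: "packs P xs 0"
| copy: "P v \<Longrightarrow> packs P r k \<Longrightarrow> packs P (u @ v @ r) (Suc k)"

text \<open>
  Meaningful if \<open>P\<close> fails for the empty list: then the length of the list bounds the numbers \<open>k\<close>.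
\<close>

definition copies :: "('x list \<Rightarrow> bool) \<Rightarrow> 'x list \<Rightarrow> nat" where
  "copies P xs = (GREATEST k. packs P xs k)"

lemma packs_length:
  assumes "packs P xs k" and "\<And>v. P v \<Longrightarrow> n \<le> length v"
  shows "k * n \<le> length xs"
  using assms(1) by induction (use assms(2) in \<open>force\<close>)+

lemma packs_prepend: "packs P ys l \<Longrightarrow> packs P (xs @ ys) l"
proof (induction rule: packs.induct)
  case (copy v r k u)
  then show ?case using packs.copy[of P v r k "xs @ u"] by simp
qed (rule packs.none)

lemma packs_append:
  assumes "packs P xs k" "packs P ys l"
  shows "packs P (xs @ ys) (k + l)"
  using assms(1)
proof induction
  case (copy v r k u)
  then show ?case using packs.copy[of P v "r @ ys" "k + l" u] by simp
qed (use assms(2) packs_prepend in simp)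

lemma packs_rev_map:
  assumes "packs P xs k" and "\<And>v. set v \<subseteq> set xs \<Longrightarrow> P v \<Longrightarrow> Q (rev (map f v))"
  shows "packs Q (rev (map f xs)) k"
  using assms
proof (induction rule: packs.induct)
  case (copy v r k u)
  have "packs Q (rev (map f r)) k"
    by (rule copy.IH) (use copy.prems in auto)
  moreover have "packs Q (rev (map f v) @ rev (map f u)) 1"
    using packs.copy[of Q "rev (map f v)" "rev (map f u)" 0 "[]"] copy.hyps copy.prems[of v]
    by (auto intro: packs.none)
  ultimately show ?case
    using packs_append[of Q "rev (map f r)" k "rev (map f v) @ rev (map f u)" 1] by simp
qed (rule packs.none)

text \<open>
  Among disjoint segments, at most one meets the single letter of \<open>zs\<close> or, if \<open>zs\<close> is empty,
  straddles the cut. All others lie in \<open>xs\<close> or in \<open>ys\<close>.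
\<close>

lemma packs_cut:
  assumes "packs P (xs @ zs @ ys) m" and "length zs \<le> 1"
  shows "\<exists>k l. packs P xs k \<and> packs P ys l \<and> m \<le> k + l + 1"
  using assms(1)
proof (induction "xs @ zs @ ys" m arbitrary: xs rule: packs.induct)
  case none
  then show ?case by (auto intro: packs.none)
next
  case (copy v r m u)
  show ?case
  proof (cases "length (u @ v) \<le> length xs")
    case True
    then obtain xs' where xs: "xs = u @ v @ xs'" and r: "r = xs' @ zs @ ys"
      using copy.hyps(4) by (auto simp: append_eq_append_conv2)
    from copy.hyps(3)[OF r] obtain k l where "packs P xs' k" "packs P ys l" "m \<le> k + l + 1"
      by blast
    then show ?thesis
      using packs.copy[of P v xs' k u] copy.hyps(1) unfolding xs by force
  next
    case False
    then have "length (xs @ zs) \<le> length (u @ v)"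
      using assms(2) by simp
    moreover have "(xs @ zs) @ ys = (u @ v) @ r"
      using copy.hyps(4) by simp
    ultimately have "ys = drop (length (xs @ zs)) (u @ v) @ r"
      by (metis append_eq_conv_conj drop_append diff_is_0_eq drop_0)
    then have "packs P ys m"
      using copy.hyps(2) by (metis packs_prepend)
    then show ?thesis using packs.none[of P xs] by force
  qed
qed

context
  fixes P :: "'x list \<Rightarrow> bool"
  assumes nonempty: "\<not> P []"
begin

lemma packs_le_length: "packs P xs k \<Longrightarrow> k \<le> length xs"
  using packs_length[of P xs k 1] nonempty by (cases xs) (auto simp: Suc_le_eq)

lemma packs_copies: "packs P xs (copies P xs)"
  unfolding copies_def by (rule GreatestI_nat[where k = 0 and b = "length xs"]) (auto intro: packs.none packs_le_length)

lemma copies_greatest: "packs P xs k \<Longrightarrow> k \<le> copies P xs"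
  unfolding copies_def by (rule Greatest_le_nat[where b = "length xs"]) (auto intro: packs_le_length)

lemma copies_cut:
  assumes "length zs \<le> 1"
  shows "copies P xs + copies P ys \<le> copies P (xs @ zs @ ys)"
    and "copies P (xs @ zs @ ys) \<le> copies P xs + copies P ys + 1"
proof -
  show "copies P xs + copies P ys \<le> copies P (xs @ zs @ ys)"
    by (intro copies_greatest packs_append packs_prepend packs_copies)
  obtain k l where "packs P xs k" "packs P ys l" "copies P (xs @ zs @ ys) \<le> k + l + 1"
    using packs_cut[OF packs_copies assms] by blast
  then show "copies P (xs @ zs @ ys) \<le> copies P xs + copies P ys + 1"
    using copies_greatest[of xs k] copies_greatest[of ys l] by linarith
qed

end


section \<open>Reduced products in an amalgam of two subgroups\<close>

definition (in monoid) lprod :: "'a list \<Rightarrow> 'a" where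
  "lprod xs = foldr (\<otimes>) xs \<one>"

definition reduced_list :: "'g set \<Rightarrow> 'g set \<Rightarrow> 'g list \<Rightarrow> bool" where
  "reduced_list A B xs \<longleftrightarrow>
     set xs \<subseteq> A \<union> B - A \<inter> B \<and> successively (\<lambda>x y. (x \<in> A) \<noteq> (y \<in> A)) xs"

lemma reduced_list_simps [simp]:
  "reduced_list A B []"
  "reduced_list A B (x # xs) \<longleftrightarrow> x \<in> A \<union> B - A \<inter> B \<and> reduced_list A B xs \<and>
     (xs \<noteq> [] \<longrightarrow> (x \<in> A) \<noteq> (hd xs \<in> A))"
  by (auto simp: reduced_list_def successively_Cons)

lemma reduced_list_append:
  "reduced_list A B (xs @ ys) \<longleftrightarrow> reduced_list A B xs \<and> reduced_list A B ys \<and>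
     (xs \<noteq> [] \<longrightarrow> ys \<noteq> [] \<longrightarrow> (last xs \<in> A) \<noteq> (hd ys \<in> A))"
  by (auto simp: reduced_list_def successively_append_iff)

text \<open>
  An internal description of \<open>A *\<^sub>C B\<close> with \<open>C = A \<inter> B\<close>: the subgroups generate, and the
  normal form theorem holds. A letter outside \<open>A \<inter> B\<close> belongs to exactly one of the subgroups, so
  membership in \<open>A\<close> alone tells its side.
\<close>

locale amalgamated_subgroups = group G for G :: "('g, 'm) monoid_scheme" (structure) +
  fixes A B :: "'g set"
  assumes subgroup_A: "subgroup A G" and subgroup_B: "subgroup B G"
    and generated: "x \<in> carrier G \<Longrightarrow> \<exists>xs. set xs \<subseteq> A \<union> B \<and> x = lprod xs"
    and reduced_nontrivial: "reduced_list A B xs \<Longrightarrow> xs \<noteq> [] \<Longrightarrow> lprod xs \<notin> A \<inter> B"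
begin

abbreviation C where "C \<equiv> A \<inter> B"
abbreviation reduced where "reduced \<equiv> reduced_list A B"
abbreviation inv_list where "inv_list xs \<equiv> rev (map (m_inv G) xs)"

lemma A_carrier [simp]: "x \<in> A \<Longrightarrow> x \<in> carrier G"
  and B_carrier [simp]: "x \<in> B \<Longrightarrow> x \<in> carrier G"
  and A_one [simp]: "\<one> \<in> A" and B_one [simp]: "\<one> \<in> B"
  and A_mult [simp]: "x \<in> A \<Longrightarrow> y \<in> A \<Longrightarrow> x \<otimes> y \<in> A"
  and B_mult [simp]: "x \<in> B \<Longrightarrow> y \<in> B \<Longrightarrow> x \<otimes> y \<in> B"
  using subgroup_A subgroup_B
  by (auto intro: subgroup.mem_carrier subgroup.one_closed subgroup.m_closed)

lemma inv_in_iff [simp]: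
  assumes "x \<in> carrier G"
  shows "inv x \<in> A \<longleftrightarrow> x \<in> A" and "inv x \<in> B \<longleftrightarrow> x \<in> B"
  using subgroup.m_inv_closed[OF subgroup_A] subgroup.m_inv_closed[OF subgroup_B] assms
  by (metis inv_inv)+

lemma mult_cancel_inv [simp]:
  assumes "x \<in> carrier G" "y \<in> carrier G"
  shows "x \<otimes> (inv x \<otimes> y) = y" and "inv x \<otimes> (x \<otimes> y) = y"
  using assms by (simp_all add: m_assoc[symmetric])

lemma mult_in_iff:
  assumes "H \<in> {A, B}" "x \<in> H" "y \<in> carrier G"
  shows "x \<otimes> y \<in> H \<longleftrightarrow> y \<in> H" and "y \<otimes> x \<in> H \<longleftrightarrow> y \<in> H"
proof -
  have H: "subgroup H G" and x: "x \<in> carrier G"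
    using assms subgroup_A subgroup_B by auto
  have "y \<in> H" if "x \<otimes> y \<in> H"
    using subgroup.m_closed[OF H subgroup.m_inv_closed[OF H assms(2)] that] x assms(3) by simp
  moreover have "y \<in> H" if "y \<otimes> x \<in> H"
    using subgroup.m_closed[OF H that subgroup.m_inv_closed[OF H assms(2)]] x assms(3)
    by (simp add: m_assoc)
  ultimately show "x \<otimes> y \<in> H \<longleftrightarrow> y \<in> H" "y \<otimes> x \<in> H \<longleftrightarrow> y \<in> H"
    using subgroup.m_closed[OF H] assms(2) by blast+
qed

lemma C_mult_in_iff [simp]:
  assumes "c \<in> A" "c \<in> B" "x \<in> carrier G"
  shows "c \<otimes> x \<in> A \<longleftrightarrow> x \<in> A" "c \<otimes> x \<in> B \<longleftrightarrow> x \<in> B"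
    and "x \<otimes> c \<in> A \<longleftrightarrow> x \<in> A" "x \<otimes> c \<in> B \<longleftrightarrow> x \<in> B"
  using assms mult_in_iff by auto

lemma lprod_simps [simp]:
  "lprod [] = \<one>" "lprod (x # xs) = x \<otimes> lprod xs"
  by (simp_all add: lprod_def)

lemma lprod_closed [simp]: "set xs \<subseteq> carrier G \<Longrightarrow> lprod xs \<in> carrier G"
  by (induction xs) auto

lemma lprod_append [simp]:
  "set xs \<subseteq> carrier G \<Longrightarrow> set ys \<subseteq> carrier G \<Longrightarrow> lprod (xs @ ys) = lprod xs \<otimes> lprod ys"
  by (induction xs) (auto simp: m_assoc)

lemma lprod_inv_list: "set xs \<subseteq> carrier G \<Longrightarrow> lprod (inv_list xs) = inv (lprod xs)"
proof (induction xs)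
  case (Cons x xs)
  moreover have "set (inv_list xs) \<subseteq> carrier G"
    using Cons.prems by auto
  ultimately show ?case by (simp add: inv_mult_group)
qed simp

lemma inv_list_inv_list: "set xs \<subseteq> carrier G \<Longrightarrow> inv_list (inv_list xs) = xs"
  by (induction xs) (auto simp: rev_map)

lemma reduced_carrier: "reduced xs \<Longrightarrow> set xs \<subseteq> carrier G"
  by (auto simp: reduced_list_def)

lemma reduced_inv_list: "reduced xs \<Longrightarrow> reduced (inv_list xs)"
proof (induction xs)
  case (Cons x xs)
  then show ?case
    by (cases xs) (auto simp: reduced_list_append)
qed simp

text \<open>
  Equality of the double cosets \<open>C g C\<close> and \<open>C h C\<close>, written without inverses.
\<close>

definition coset_equiv :: "'g \<Rightarrow> 'g \<Rightarrow> bool" (infix "\<sim>" 50) where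
  "g \<sim> h \<longleftrightarrow> g \<in> carrier G \<and> h \<in> carrier G \<and> (\<exists>c\<in>C. \<exists>d\<in>C. g \<otimes> d = c \<otimes> h)"

lemma coset_equivI:
  "g \<in> carrier G \<Longrightarrow> h \<in> carrier G \<Longrightarrow> c \<in> C \<Longrightarrow> d \<in> C \<Longrightarrow> g \<otimes> d = c \<otimes> h \<Longrightarrow> g \<sim> h"
  by (auto simp: coset_equiv_def)

lemma coset_equiv_refl: "g \<in> carrier G \<Longrightarrow> g \<sim> g"
  by (rule coset_equivI[of _ _ "\<one>" "\<one>"]) auto

lemma coset_equiv_trans:
  assumes "g \<sim> h" "h \<sim> k"
  shows "g \<sim> k"
proof -
  obtain c d c' d' where *: "c \<in> C" "d \<in> C" "g \<otimes> d = c \<otimes> h" "c' \<in> C" "d' \<in> C" "h \<otimes> d' = c' \<otimes> k"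
    and carr: "g \<in> carrier G" "h \<in> carrier G" "k \<in> carrier G"
    using assms unfolding coset_equiv_def by blast
  have "g \<otimes> (d \<otimes> d') = (c \<otimes> h) \<otimes> d'"
    using * carr by (simp add: m_assoc[symmetric])
  also have "\<dots> = (c \<otimes> c') \<otimes> k"
    using * carr by (simp add: m_assoc)
  finally show ?thesis
    using * carr by (intro coset_equivI[of _ _ "c \<otimes> c'" "d \<otimes> d'"]) auto
qed

lemma coset_equiv_inv:
  assumes "g \<sim> h"
  shows "inv g \<sim> inv h"
proof -
  obtain c d where *: "c \<in> C" "d \<in> C" "g \<otimes> d = c \<otimes> h"
    and carr: "g \<in> carrier G" "h \<in> carrier G"
    using assms unfolding coset_equiv_def by blast
  have "inv d \<otimes> inv g = inv (g \<otimes> d)"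
    using *(1,2) carr by (simp add: inv_mult_group)
  also have "\<dots> = inv h \<otimes> inv c"
    using *(1,2) carr by (simp add: *(3) inv_mult_group)
  finally have "inv g = d \<otimes> (inv h \<otimes> inv c)"
    using * carr by (metis A_carrier Int_iff inv_closed mult_cancel_inv(1))
  then have "inv g \<otimes> c = d \<otimes> inv h"
    using * carr by (simp add: m_assoc)
  then show ?thesis
    using * carr by (intro coset_equivI[of _ _ d c]) auto
qed

lemma coset_equiv_sym:
  assumes "g \<sim> h"
  shows "h \<sim> g"
proof -
  obtain c d where *: "c \<in> C" "d \<in> C" "g \<otimes> d = c \<otimes> h"
    and carr: "g \<in> carrier G" "h \<in> carrier G"
    using assms unfolding coset_equiv_def by blast
  have "h \<otimes> inv d = inv c \<otimes> (c \<otimes> h) \<otimes> inv d"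
    using * carr by simp
  also have "\<dots> = inv c \<otimes> g"
    using * carr by (simp add: m_assoc flip: *(3))
  finally show ?thesis
    using * carr by (intro coset_equivI[of _ _ "inv c" "inv d"]) auto
qed

lemma coset_equiv_multI:
  assumes "g \<in> carrier G" "c \<in> C" "d \<in> C" shows "c \<otimes> g \<otimes> d \<sim> g"
  using assms by (intro coset_equivI[of _ _ c "inv d"]) (auto simp: m_assoc)

text \<open>
  An element of \<open>C\<close> on the left merges with the first letter and leaves its side unchanged; it
  remains as the factor \<open>d\<close> if there is no letter.
\<close>

lemma absorb_left:
  assumes "reduced ys" "c \<in> C"
  obtains zs d where "reduced zs" "map (\<lambda>y. y \<in> A) zs = map (\<lambda>y. y \<in> A) ys" "d \<in> C"
    "c \<otimes> lprod ys = lprod zs \<otimes> d"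
proof (cases ys)
  case Nil
  then show ?thesis using assms by (intro that[of "[]" c]) auto
next
  case (Cons y ys')
  then show ?thesis
    using assms reduced_carrier[OF assms(1)]
    by (intro that[of "(c \<otimes> y) # ys'" \<one>]) (auto simp: m_assoc)
qed

text \<open>
  Compare the first letters \<open>x\<close> and \<open>y\<close>. If \<open>x\<inverse> c y\<close> were not in \<open>C\<close>, the inverse of \<open>xs\<close>
  followed by \<open>c ys\<close> would become a nonempty reduced list with product in \<open>C\<close>, after merging the two
  middle letters when they lie on the same side. So this element is in \<open>C\<close> and can be passed on to
  the remaining letters.
\<close>

lemma reduced_unique:
  assumes "reduced xs" "reduced ys" "c \<in> C" "d \<in> C" "lprod xs \<otimes> d = c \<otimes> lprod ys"
  shows "length xs = length ys \<and> (\<forall>k. \<exists>e\<in>C. lprod (take k xs) \<otimes> e = c \<otimes> lprod (take k ys))"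
  using assms
proof (induction xs arbitrary: ys c)
  case Nil
  have "ys = []"
  proof (rule ccontr)
    assume "ys \<noteq> []"
    then have "lprod ys \<notin> C" using Nil reduced_nontrivial by blast
    moreover have "lprod ys = inv c \<otimes> d"
      using Nil reduced_carrier[OF Nil.prems(2)] by simp
    ultimately show False using Nil by auto
  qed
  then show ?case using Nil by (auto intro: bexI[of _ c])
next
  case (Cons x xs)
  note carr = reduced_carrier[OF Cons.prems(1)] reduced_carrier[OF Cons.prems(2)]
  have c: "c \<in> A" "c \<in> B" and d: "d \<in> A" "d \<in> B" using Cons.prems by auto
  show ?case
  proof (cases ys)
    case Nil
    have "lprod (x # xs) = c \<otimes> inv d"
      using Cons.prems(5) carr c d Nil by (simp add: inv_solve_right m_assoc)
    then have "lprod (x # xs) \<in> C" using c d by auto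
    then show ?thesis using reduced_nontrivial[OF Cons.prems(1)] by simp
  next
    case ys: (Cons y ys')
    \<comment> \<open>the only candidate for the element passed on: it satisfies \<open>x e = c y\<close>\<close>
    define e where "e = inv x \<otimes> c \<otimes> y"
    have e: "e \<in> carrier G" "x \<otimes> e = c \<otimes> y"
      using carr c ys by (auto simp: e_def m_assoc)
    have red: "reduced (inv_list xs)" "reduced ys'"
      using Cons.prems reduced_inv_list ys by auto
    have carr': "set (inv_list xs) \<subseteq> carrier G" "set ys' \<subseteq> carrier G" "x \<in> carrier G" "y \<in> carrier G"
      using carr ys by auto
    have step: "lprod xs \<otimes> d = e \<otimes> lprod ys'"
    proof -
      have "x \<otimes> (lprod xs \<otimes> d) = x \<otimes> (e \<otimes> lprod ys')"
        using Cons.prems(5) carr e c d ys by (simp add: m_assoc[symmetric])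
      then show ?thesis using carr e c d ys by simp
    qed
    have e_C: "e \<in> C"
    proof (rule ccontr)
      assume notin: "e \<notin> C"
      show False
      proof (cases "(x \<in> A) = (y \<in> A)")
        case True
        then have "e \<in> A \<union> B - C" and "(e \<in> A) = (x \<in> A)"
          using notin Cons.prems ys c by (auto simp: e_def)
        then have "reduced (inv_list xs @ e # ys')"
          using red Cons.prems ys True by (cases xs) (auto simp: reduced_list_append)
        moreover have "lprod (inv_list xs @ e # ys') = d"
          using carr carr' e d by (simp add: lprod_inv_list flip: step)
        ultimately show False
          using reduced_nontrivial[of "inv_list xs @ e # ys'"] d by auto
      next
        case False
        have "reduced (inv_list (x # xs))"
          using Cons.prems reduced_inv_list by blast
        then have "reduced (inv_list (x # xs) @ (c \<otimes> y) # ys')"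
          using red Cons.prems ys False carr' c by (auto simp: reduced_list_append)
        moreover have "lprod (inv_list (x # xs) @ (c \<otimes> y) # ys') = inv (lprod (x # xs)) \<otimes> (c \<otimes> lprod ys)"
          using carr carr' c ys by (simp add: lprod_inv_list m_assoc inv_mult_group)
        then have "lprod (inv_list (x # xs) @ (c \<otimes> y) # ys') = d"
          using carr d Cons.prems(5) by (simp flip: Cons.prems(5))
        ultimately show False
          using reduced_nontrivial[of "inv_list (x # xs) @ (c \<otimes> y) # ys'"] d by auto
      qed
    qed
    have IH: "length xs = length ys' \<and>
        (\<forall>k. \<exists>e'\<in>C. lprod (take k xs) \<otimes> e' = e \<otimes> lprod (take k ys'))"
      using Cons.IH[of ys' e] Cons.prems ys e_C step by simp
    have "\<exists>e'\<in>C. lprod (take k (x # xs)) \<otimes> e' = c \<otimes> lprod (take k ys)" for k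
    proof (cases k)
      case 0
      then show ?thesis using c by (auto intro!: bexI[of _ c])
    next
      case (Suc k')
      from IH obtain e' where e': "e' \<in> C" "lprod (take k' xs) \<otimes> e' = e \<otimes> lprod (take k' ys')"
        by blast
      have tk: "set (take k' xs) \<subseteq> carrier G" "set (take k' ys') \<subseteq> carrier G"
        using carr carr' set_take_subset by force+
      have "lprod (take k (x # xs)) \<otimes> e' = x \<otimes> (e \<otimes> lprod (take k' ys'))"
        using e' tk carr' by (simp add: Suc m_assoc)
      also have "\<dots> = c \<otimes> lprod (take k ys)"
        using tk carr' e c by (simp add: Suc ys m_assoc[symmetric])
      finally show ?thesis using e' by blast
    qed
    with IH ys show ?thesis by simp
  qed
qed

text \<open>
  The form in which uniqueness is used: counting copies by double cosets does not depend on the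
  reduced list.
\<close>

lemma coset_equiv_split:
  assumes "reduced (u @ v)" "reduced ys" "lprod (u @ v) \<sim> lprod ys"
  obtains u' v' where "ys = u' @ v'" "length u' = length u" "length v' = length v"
    "lprod u \<sim> lprod u'" "lprod v \<sim> lprod v'"
proof -
  obtain c d where cd: "c \<in> C" "d \<in> C" "lprod (u @ v) \<otimes> d = c \<otimes> lprod ys"
    using assms(3) unfolding coset_equiv_def by blast
  define u' v' where "u' = take (length u) ys" and "v' = drop (length u) ys"
  have ys: "ys = u' @ v'" by (simp add: u'_def v'_def)
  have carr: "set u \<subseteq> carrier G" "set v \<subseteq> carrier G" "set u' \<subseteq> carrier G" "set v' \<subseteq> carrier G"
    using reduced_carrier[OF assms(1)] reduced_carrier[OF assms(2)] by (auto simp: ys)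
  note uniq = reduced_unique[OF assms(1,2) cd]
  have len: "length u + length v = length ys" using uniq by simp
  obtain e where e: "e \<in> C" "lprod u \<otimes> e = c \<otimes> lprod u'"
    using spec[OF conjunct2[OF uniq], of "length u"] by (auto simp: u'_def)
  have "lprod u \<otimes> (lprod v \<otimes> d) = lprod u \<otimes> e \<otimes> lprod v'"
    using cd e carr by (simp add: ys m_assoc)
  then have "lprod u \<otimes> (lprod v \<otimes> d) = lprod u \<otimes> (e \<otimes> lprod v')"
    using e(1) carr by (simp add: m_assoc)
  then have "lprod v \<otimes> d = e \<otimes> lprod v'"
    using e(1) cd(2) carr by simp
  then have "lprod v \<sim> lprod v'"
    using carr by (intro coset_equivI[OF _ _ e(1) cd(2)] lprod_closed)
  moreover have "lprod u \<sim> lprod u'"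
    using carr e(2) by (intro coset_equivI[OF _ _ cd(1) e(1)] lprod_closed)
  moreover have "length u' = length u" "length v' = length v"
    using len by (simp_all add: u'_def v'_def flip: len)
  ultimately show ?thesis using ys by (intro that[of u' v'])
qed

lemma packs_transfer:
  assumes "packs P xs k" "reduced xs" "reduced ys" "lprod xs \<sim> lprod ys"
    and "\<And>v v'. P v \<Longrightarrow> length v' = length v \<Longrightarrow> lprod v \<sim> lprod v' \<Longrightarrow> P v'"
  shows "packs P ys k"
  using assms(1-4)
proof (induction arbitrary: ys rule: packs.induct)
  case (copy v r k u)
  obtain u' s where 1: "ys = u' @ s" "lprod (v @ r) \<sim> lprod s"
    using coset_equiv_split[OF copy.prems] by metis
  have "reduced (v @ r)" "reduced s"
    using copy.prems 1 by (auto simp: reduced_list_append)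
  from coset_equiv_split[OF this 1(2)] obtain v' r' where 2: "s = v' @ r'" "length v' = length v"
    "lprod v \<sim> lprod v'" "lprod r \<sim> lprod r'" by metis
  have "packs P r' k"
    using copy.IH[of r'] copy.prems 1 2 by (auto simp: reduced_list_append)
  then show ?case
    using packs.copy[of P v' r' k u'] assms(5)[OF copy.hyps(1) 2(2,3)] 1 2 by simp
qed (rule packs.none)

text \<open>
  The part \<open>z\<close> is where the paths of the two elements from the base edge of the Bass--Serre tree run
  together. Only the second list is altered to share \<open>z\<close> literally, by moving elements of \<open>C\<close>. That
  this keeps the sides of all its letters is part of the claim, because the induction needs it to see that
  prepending a letter leaves the list reduced.
\<close>

lemma tripod:
  assumes "reduced xs" "reduced ys"
  shows "\<exists>z p q d. xs = z @ p \<and> reduced (z @ q) \<and> d \<in> C \<and> lprod ys = lprod (z @ q) \<otimes> d \<and>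
     map (\<lambda>y. y \<in> A) (z @ q) = map (\<lambda>y. y \<in> A) ys \<and>
     (p \<noteq> [] \<longrightarrow> q \<noteq> [] \<longrightarrow> (hd p \<in> A) = (hd q \<in> A) \<longrightarrow> inv (hd p) \<otimes> hd q \<notin> C)"
  using assms
proof (induction xs arbitrary: ys)
  case Nil
  then show ?case using reduced_carrier[of ys]
    by (intro exI[of _ "[]"] exI[of _ ys] exI[of _ \<one>]) auto
next
  case (Cons x xs)
  note carr = reduced_carrier[OF Cons.prems(1)] reduced_carrier[OF Cons.prems(2)]
  show ?case
  proof (cases "ys \<noteq> [] \<and> (x \<in> A) = (hd ys \<in> A) \<and> inv x \<otimes> hd ys \<in> C")
    case False
    have "lprod ys = lprod ([] @ ys) \<otimes> \<one>" "x # xs = [] @ x # xs" "\<one> \<in> C" "reduced ([] @ ys)"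
      using carr Cons.prems(2) by simp_all
    moreover have "x # xs \<noteq> [] \<longrightarrow> ys \<noteq> [] \<longrightarrow>
        (hd (x # xs) \<in> A) = (hd ys \<in> A) \<longrightarrow> inv (hd (x # xs)) \<otimes> hd ys \<notin> C"
      using False unfolding list.sel by blast
    ultimately show ?thesis by (metis append_Nil)
  next
    case True
    then obtain y ys' where ys: "ys = y # ys'" and xy: "(x \<in> A) = (y \<in> A)" "inv x \<otimes> y \<in> C"
      by (cases ys) auto
    obtain us d where us: "reduced us" "map (\<lambda>y. y \<in> A) us = map (\<lambda>y. y \<in> A) ys'" "d \<in> C"
      "(inv x \<otimes> y) \<otimes> lprod ys' = lprod us \<otimes> d"
      using absorb_left[of ys' "inv x \<otimes> y"] Cons.prems xy ys by auto
    have redxs: "reduced xs" using Cons.prems(1) by simp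
    obtain z p q d' where IH: "xs = z @ p" "reduced (z @ q)" "d' \<in> C" "lprod us = lprod (z @ q) \<otimes> d'"
      "map (\<lambda>y. y \<in> A) (z @ q) = map (\<lambda>y. y \<in> A) us"
      "p \<noteq> [] \<longrightarrow> q \<noteq> [] \<longrightarrow> (hd p \<in> A) = (hd q \<in> A) \<longrightarrow> inv (hd p) \<otimes> hd q \<notin> C"
      using Cons.IH[OF redxs us(1)] by blast
    have eq: "map (\<lambda>y. y \<in> A) (z @ q) = map (\<lambda>y. y \<in> A) ys'" using IH(5) us(2) by simp
    then have "z @ q \<noteq> [] \<Longrightarrow> (x \<in> A) \<noteq> (hd (z @ q) \<in> A)"
      using Cons.prems(2) ys xy by (cases "z @ q"; cases ys') auto
    then have red: "reduced ((x # z) @ q)"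
      using Cons.prems(1) IH(2) by simp
    note carr' = reduced_carrier[OF IH(2)] reduced_carrier[OF us(1)]
    have "lprod ys = x \<otimes> ((inv x \<otimes> y) \<otimes> lprod ys')"
      using carr ys by (simp add: m_assoc)
    also have "\<dots> = x \<otimes> (lprod (z @ q) \<otimes> d' \<otimes> d)"
      by (simp only: us(4) IH(4))
    also have "\<dots> = lprod ((x # z) @ q) \<otimes> (d' \<otimes> d)"
      using carr carr' us(3) IH(3) by (simp add: m_assoc del: lprod_append)
    finally have "lprod ys = lprod ((x # z) @ q) \<otimes> (d' \<otimes> d)" .
    moreover have "x # xs = (x # z) @ p" "d' \<otimes> d \<in> C"
      using IH(1,3) us(3) by simp_all
    moreover have "map (\<lambda>y. y \<in> A) ((x # z) @ q) = map (\<lambda>y. y \<in> A) ys"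
      using eq ys xy(1) by simp
    ultimately show ?thesis using red IH(6) by blast
  qed
qed

lemma reduced_exists:
  assumes "g \<in> carrier G"
  obtains xs d where "reduced xs" "d \<in> C" "g = lprod xs \<otimes> d"
proof -
  obtain us where us: "set us \<subseteq> A \<union> B" "g = lprod us"
    using generated[OF assms] by blast
  have "\<exists>xs d. reduced xs \<and> d \<in> C \<and> lprod us = lprod xs \<otimes> d"
    using us(1)
  proof (induction us)
    case Nil
    then show ?case by (intro exI[of _ "[]"] exI[of _ \<one>]) auto
  next
    case (Cons x us)
    then obtain xs d where IH: "reduced xs" "d \<in> C" "lprod us = lprod xs \<otimes> d" by auto
    note carr = reduced_carrier[OF IH(1)]
    have x: "x \<in> A \<union> B" using Cons.prems by auto
    have absorb: ?case if y: "y \<in> C" "reduced ys" "lprod (x # us) = y \<otimes> lprod ys \<otimes> d" for y ys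
    proof -
      obtain zs d' where zs: "reduced zs" "d' \<in> C" "y \<otimes> lprod ys = lprod zs \<otimes> d'"
        using absorb_left[OF y(2,1)] by metis
      then show ?thesis
        using y(3) IH reduced_carrier[OF zs(1)]
        by (intro exI[of _ zs] exI[of _ "d' \<otimes> d"]) (auto simp: m_assoc)
    qed
    show ?case
    proof (cases "x \<in> C")
      case True
      then show ?thesis using carr IH by (intro absorb[of x xs]) (auto simp: m_assoc)
    next
      case notin: False
      show ?thesis
      proof (cases "xs \<noteq> [] \<and> (x \<in> A) = (hd xs \<in> A)")
        case False
        then show ?thesis using notin x IH carr
          by (intro exI[of _ "x # xs"] exI[of _ d]) (auto simp: m_assoc)
      next
        case True
        then obtain y ys where xs: "xs = y # ys" and xy: "(x \<in> A) = (y \<in> A)" by (cases xs) auto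
        have prod: "lprod (x # us) = x \<otimes> y \<otimes> lprod ys \<otimes> d"
          using x carr IH xs by (auto simp: m_assoc)
        show ?thesis
        proof (cases "x \<otimes> y \<in> C")
          case True
          then show ?thesis using prod IH xs by (intro absorb[of "x \<otimes> y" ys]) auto
        next
          case False
          have same: "x \<otimes> y \<in> A \<union> B - C" "(x \<otimes> y \<in> A) = (y \<in> A)"
            using False x notin xy IH(1) xs by auto
          then show ?thesis using prod IH xs x carr
            by (intro exI[of _ "(x \<otimes> y) # ys"] exI[of _ d]) (auto simp: m_assoc)
        qed
      qed
    qed
  qed
  with us that show ?thesis by blast
qed

end


section \<open>The counting quasimorphism\<close>

context amalgamated_subgroups
begin

definition copy_of :: "'g list \<Rightarrow> 'g list \<Rightarrow> bool" where
  "copy_of w v \<longleftrightarrow> length v = length w \<and> lprod v \<sim> lprod w"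

definition signed_copies :: "'g list \<Rightarrow> 'g list \<Rightarrow> real" where
  "signed_copies w xs = real (copies (copy_of w) xs) - real (copies (copy_of (inv_list w)) xs)"

lemma signed_copies_cut:
  assumes "w \<noteq> []" "length zs \<le> 1"
  shows "\<bar>signed_copies w (xs @ zs @ ys) - signed_copies w xs - signed_copies w ys\<bar> \<le> 1"
proof -
  have "\<not> copy_of w []" "\<not> copy_of (inv_list w) []"
    using assms(1) by (auto simp: copy_of_def)
  from copies_cut[where P = "copy_of w", OF this(1) assms(2), of xs ys]
    copies_cut[where P = "copy_of (inv_list w)", OF this(2) assms(2), of xs ys]
  show ?thesis unfolding signed_copies_def by linarith
qed

lemma packs_inv_list:
  assumes "packs (copy_of w) xs k" "set w \<subseteq> carrier G" "set xs \<subseteq> carrier G"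
  shows "packs (copy_of (inv_list w)) (inv_list xs) k"
  using assms(1)
proof (rule packs_rev_map)
  fix v
  assume "set v \<subseteq> set xs" "copy_of w v"
  then show "copy_of (inv_list w) (inv_list v)"
    using assms(2,3) coset_equiv_inv by (auto simp: copy_of_def lprod_inv_list)
qed

lemma copies_inv_list:
  assumes "set w \<subseteq> carrier G" "set xs \<subseteq> carrier G"
  shows "copies (copy_of (inv_list w)) (inv_list xs) = copies (copy_of w) xs"
proof -
  have "set (inv_list w) \<subseteq> carrier G" "set (inv_list xs) \<subseteq> carrier G"
    using assms by auto
  then have "packs (copy_of (inv_list w)) (inv_list xs) k \<longleftrightarrow> packs (copy_of w) xs k" for k
    using packs_inv_list[of w xs k] packs_inv_list[of "inv_list w" "inv_list xs" k]
    unfolding inv_list_inv_list[OF assms(1)] inv_list_inv_list[OF assms(2)] using assms by blast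
  then show ?thesis by (simp add: copies_def)
qed

lemma signed_copies_inv_list:
  assumes "set w \<subseteq> carrier G" "set xs \<subseteq> carrier G"
  shows "signed_copies w (inv_list xs) = - signed_copies w xs"
proof -
  have "set (inv_list xs) \<subseteq> carrier G" using assms by auto
  from copies_inv_list[OF assms] copies_inv_list[OF assms(1) this]
  show ?thesis unfolding signed_copies_def inv_list_inv_list[OF assms(2)] by simp
qed

lemma signed_copies_cong:
  assumes "reduced xs" "reduced ys" "lprod xs \<sim> lprod ys"
  shows "signed_copies w xs = signed_copies w ys"
proof -
  have "copy_of w' v'" if "copy_of w' v" "length v' = length v" "lprod v \<sim> lprod v'" for w' v v'
    using that unfolding copy_of_def by (metis coset_equiv_sym coset_equiv_trans)
  then have "packs (copy_of w') xs k \<longleftrightarrow> packs (copy_of w') ys k" for w' k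
    using packs_transfer[OF _ assms, of "copy_of w'" k]
      packs_transfer[OF _ assms(2,1) coset_equiv_sym[OF assms(3)], of "copy_of w'" k] by blast
  then show ?thesis by (simp add: signed_copies_def copies_def)
qed

definition counting_qm :: "'g list \<Rightarrow> 'g \<Rightarrow> real" where
  "counting_qm w g = signed_copies w (SOME xs. reduced xs \<and> g \<sim> lprod xs)"

lemma counting_qm_eq:
  assumes "reduced xs" "g \<sim> lprod xs"
  shows "counting_qm w g = signed_copies w xs"
proof -
  define ys where "ys = (SOME xs. reduced xs \<and> g \<sim> lprod xs)"
  have "reduced ys \<and> g \<sim> lprod ys"
    unfolding ys_def by (rule someI[of _ xs]) (use assms in blast)
  then show ?thesis
    unfolding counting_qm_def ys_def[symmetric]
    using signed_copies_cong assms by (metis coset_equiv_sym coset_equiv_trans)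
qed

text \<open>
  Cancellation in \<open>x y\<close> is seen by comparing \<open>x\<inverse>\<close> with \<open>y\<close>. After the common part \<open>z\<close> the
  two lists either start on different sides, and nothing merges, or their first letters merge
  into the single letter \<open>a\<inverse> b\<close>. In both cases each of the three values is obtained by cutting a list
  once, at the cost of one.
\<close>

lemma counting_qm_defect:
  assumes w: "reduced w" "w \<noteq> []"
  shows "defect_bound G (counting_qm w) 3"
  unfolding defect_bound_def
proof (intro conjI ballI)
  fix x y
  assume xy: "x \<in> carrier G" "y \<in> carrier G"
  let ?\<phi> = "counting_qm w" and ?s = "signed_copies w"
  have w_carr: "set w \<subseteq> carrier G" using w reduced_carrier by blast
  \<comment> \<open>Exact products, not just double cosets, are needed here: the factors in \<open>C\<close> must stay on the
    outer sides of \<open>x y\<close>.\<close>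
  obtain xs d where xs: "reduced xs" "d \<in> C" "inv x = lprod xs \<otimes> d"
    using reduced_exists[of "inv x"] xy by auto
  obtain ys e where ys: "reduced ys" "e \<in> C" "y = lprod ys \<otimes> e"
    using reduced_exists[OF xy(2)] by blast
  obtain z p q f where tri: "xs = z @ p" "reduced (z @ q)" "f \<in> C" "lprod ys = lprod (z @ q) \<otimes> f"
    "p \<noteq> [] \<longrightarrow> q \<noteq> [] \<longrightarrow> (hd p \<in> A) = (hd q \<in> A) \<longrightarrow> inv (hd p) \<otimes> hd q \<notin> C"
    using tripod[OF xs(1) ys(1)] by blast
  have red: "reduced p" "reduced q" "reduced (inv_list p)"
    using xs tri reduced_inv_list by (auto simp: reduced_list_append)
  have carr: "set z \<subseteq> carrier G" "set p \<subseteq> carrier G" "set q \<subseteq> carrier G"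
    "set (inv_list p) \<subseteq> carrier G" "set xs \<subseteq> carrier G"
    using reduced_carrier[OF xs(1)] reduced_carrier[OF tri(2)] tri(1) by auto
  have x_eq: "x = inv d \<otimes> inv (lprod xs)"
    using inv_inv[OF xy(1)] xs carr by (simp add: inv_mult_group)
  have y_eq: "y = lprod z \<otimes> lprod q \<otimes> (f \<otimes> e)"
    using ys tri carr by (simp add: m_assoc)
  have x_val: "?\<phi> x = - ?s (z @ p)"
  proof -
    have "x = inv d \<otimes> lprod (inv_list xs) \<otimes> \<one>"
      using x_eq xs carr by (simp add: lprod_inv_list)
    also have "\<dots> \<sim> lprod (inv_list xs)"
      using xs carr by (intro coset_equiv_multI lprod_closed) auto
    finally show ?thesis
      using counting_qm_eq[OF reduced_inv_list[OF xs(1)]] signed_copies_inv_list[OF w_carr carr(5)]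
      by (simp add: tri(1))
  qed
  have y_val: "?\<phi> y = ?s (z @ q)"
  proof (rule counting_qm_eq[OF tri(2)])
    have "y = \<one> \<otimes> lprod (z @ q) \<otimes> (f \<otimes> e)"
      using y_eq carr by simp
    also have "\<dots> \<sim> lprod (z @ q)"
      using ys tri carr by (intro coset_equiv_multI lprod_closed) auto
    finally show "y \<sim> lprod (z @ q)" .
  qed
  have xy_equiv: "x \<otimes> y \<sim> inv (lprod p) \<otimes> lprod q"
  proof -
    have "x \<otimes> y = inv d \<otimes> (inv (lprod p) \<otimes> lprod q) \<otimes> (f \<otimes> e)"
      using carr xs(2) ys(2) tri(3) by (simp add: x_eq y_eq tri(1) m_assoc inv_mult_group)
    also have "\<dots> \<sim> inv (lprod p) \<otimes> lprod q"
      using ys tri xs carr by (intro coset_equiv_multI) auto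
    finally show ?thesis .
  qed
  show "\<bar>?\<phi> x + ?\<phi> y - ?\<phi> (x \<otimes> y)\<bar> \<le> 3"
  proof (cases "p \<noteq> [] \<and> q \<noteq> [] \<and> (hd p \<in> A) = (hd q \<in> A)")
    case False
    have "p \<noteq> [] \<Longrightarrow> last (inv_list p) = inv (hd p)" "p \<noteq> [] \<Longrightarrow> hd p \<in> carrier G"
      using carr by (cases p; simp)+
    then have "reduced (inv_list p @ [] @ q)"
      using red False by (auto simp: reduced_list_append)
    moreover have "lprod (inv_list p @ [] @ q) = inv (lprod p) \<otimes> lprod q"
      using carr by (simp add: lprod_inv_list)
    ultimately have "?\<phi> (x \<otimes> y) = ?s (inv_list p @ [] @ q)"
      using xy_equiv counting_qm_eq by metis
    then show ?thesis
      using signed_copies_cut[OF w(2), of "[]" "inv_list p" q]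
        signed_copies_cut[OF w(2), of "[]" z p] signed_copies_cut[OF w(2), of "[]" z q]
        signed_copies_inv_list[OF w_carr carr(2)] x_val y_val by simp
  next
    case True
    then obtain a p' b q' where pq: "p = a # p'" "q = b # q'" and ab: "(a \<in> A) = (b \<in> A)"
      by (cases p; cases q) auto
    define s where "s = inv a \<otimes> b"
    have s: "s \<notin> C" using tri(5) pq ab by (simp add: s_def)
    have carr': "a \<in> carrier G" "b \<in> carrier G" "set p' \<subseteq> carrier G" "set q' \<subseteq> carrier G"
      "set (inv_list p') \<subseteq> carrier G" "s \<in> carrier G"
      using carr pq by (auto simp: s_def)
    have s': "s \<in> A \<union> B - C" "s \<in> A \<longleftrightarrow> a \<in> A"
      using s red pq ab carr' by (auto simp: s_def)
    have "reduced (inv_list p' @ [s] @ q')"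
      using red s' pq ab by (auto simp: reduced_list_append)
    moreover have "lprod (inv_list p' @ [s] @ q') = inv (lprod p) \<otimes> lprod q"
      using carr' by (simp add: lprod_inv_list pq inv_mult_group m_assoc s_def)
    ultimately have "?\<phi> (x \<otimes> y) = ?s (inv_list p' @ [s] @ q')"
      using xy_equiv counting_qm_eq by metis
    then show ?thesis
      using signed_copies_cut[OF w(2), of "[s]" "inv_list p'" q']
        signed_copies_cut[OF w(2), of "[a]" z p'] signed_copies_cut[OF w(2), of "[b]" z q']
        signed_copies_inv_list[OF w_carr carr'(3)] x_val y_val by (simp add: pq)
  qed
qed simp

end

lemma nth_concat_replicate:
  "p < m * length w \<Longrightarrow> concat (replicate m w) ! p = w ! (p mod length w)"
proof (induction m arbitrary: p)
  case (Suc m)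
  then show ?case
    by (cases "p < length w") (auto simp: nth_append le_mod_geq)
qed simp

lemma segment_of_power_is_rotation:
  assumes "concat (replicate m w) = u @ v @ r" "length v = length w"
  shows "v = rotate (length u) w"
proof (rule nth_equalityI)
  fix p
  assume p: "p < length v"
  have len: "m * length w = length u + length v + length r"
    using arg_cong[OF assms(1), of length] by (simp add: length_concat sum_list_replicate)
  have "v ! p = concat (replicate m w) ! (length u + p)"
    using p by (simp add: assms(1) nth_append)
  also have "\<dots> = w ! ((length u + p) mod length w)"
    using p len by (intro nth_concat_replicate) simp
  finally show "v ! p = rotate (length u) w ! p"
    using p assms(2) by (simp add: nth_rotate add.commute)
qed (simp add: assms(2))

context amalgamated_subgroups
begin

lemma reduced_power:
  assumes "reduced (w @ w)"
  shows "reduced (concat (replicate m w))"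
proof (induction m)
  case (Suc m)
  show ?case
  proof (cases "m = 0 \<or> w = []")
    case True
    with assms show ?thesis by (auto simp: reduced_list_append)
  next
    case False
    then have "hd (concat (replicate m w)) = hd w"
      by (cases m) auto
    with assms Suc False show ?thesis by (auto simp: reduced_list_append)
  qed
qed simp

lemma lprod_power:
  "set w \<subseteq> carrier G \<Longrightarrow> lprod (concat (replicate m w)) = lprod w [^] m"
proof (induction m)
  case (Suc m)
  moreover have "set (concat (replicate m w)) \<subseteq> carrier G"
    using Suc.prems by (auto split: if_splits)
  ultimately have "lprod (concat (replicate (Suc m) w)) = lprod w \<otimes> lprod w [^] m"
    by simp
  also have "\<dots> = lprod w [^] Suc m"
    by (rule nat_pow_Suc2[symmetric]) (use Suc.prems in simp)
  finally show ?case .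
qed simp

text \<open>
  The power of \<open>w\<close> has at least \<open>m\<close> disjoint copies of \<open>w\<close> by construction and at most \<open>m\<close> by
  length, so copies at shifted positions, as when \<open>w\<close> is itself a proper power, do no harm.
\<close>

lemma counting_qm_power:
  assumes w: "reduced (w @ w)" "w \<noteq> []"
    and no_inv: "\<And>n. \<not> lprod (rotate n w) \<sim> inv (lprod w)"
  shows "counting_qm w (lprod w [^] m) = real m"
proof -
  define ws where "ws = concat (replicate m w)"
  have carr: "set w \<subseteq> carrier G" using reduced_carrier[OF w(1)] by simp
  have "packs (copy_of w) ws m"
    unfolding ws_def
  proof (induction m)
    case (Suc m)
    have "copy_of w w" using carr by (simp add: copy_of_def coset_equiv_refl)
    from packs.copy[of "copy_of w", OF this Suc, of "[]"] show ?case by simp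
  qed (simp add: packs.none)
  moreover have "\<not> copy_of w []" using w by (simp add: copy_of_def)
  ultimately have "m \<le> copies (copy_of w) ws" by (intro copies_greatest)
  moreover have "copies (copy_of w) ws * length w \<le> length ws"
    by (rule packs_length[OF packs_copies]) (use w in \<open>auto simp: copy_of_def\<close>)
  then have "copies (copy_of w) ws \<le> m"
    using w(2) by (simp add: ws_def length_concat sum_list_replicate)
  moreover have "copies (copy_of (inv_list w)) ws = 0"
  proof (rule ccontr)
    let ?k = "copies (copy_of (inv_list w)) ws"
    assume "?k \<noteq> 0"
    have "packs (copy_of (inv_list w)) ws ?k"
      by (rule packs_copies) (use w in \<open>simp add: copy_of_def\<close>)
    then show False
    proof cases
      case (copy v r k u)
      then have "v = rotate (length u) w"
        by (intro segment_of_power_is_rotation[of m w u v r]) (auto simp: ws_def copy_of_def)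
      then show False
        using copy(3) no_inv carr by (auto simp: copy_of_def lprod_inv_list)
    qed (use \<open>?k \<noteq> 0\<close> in simp)
  qed
  ultimately have "signed_copies w ws = real m" by (simp add: signed_copies_def)
  moreover have "lprod w [^] m \<sim> lprod ws"
    using carr by (simp add: ws_def lprod_power coset_equiv_refl)
  ultimately show ?thesis
    using counting_qm_eq[of ws "lprod w [^] m"] reduced_power[OF w(1)] by (simp add: ws_def)
qed

theorem homogeneous_quasimorphism_detecting:
  assumes w: "reduced (w @ w)" "w \<noteq> []"
    and no_inv: "\<And>n. \<not> lprod (rotate n w) \<sim> inv (lprod w)"
  obtains h where "homogeneous G h" "defect_bound G h 12" "h (lprod w) = 1"
proof -
  have carr: "lprod w \<in> carrier G" using reduced_carrier[OF w(1)] by simp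
  have "reduced w" using w by (simp add: reduced_list_append)
  from counting_qm_defect[OF this w(2)] obtain h where h: "homogeneous G h" "defect_bound G h (4 * 3)"
    "\<And>x. x \<in> carrier G \<Longrightarrow> \<bar>counting_qm w x - h x\<bar> \<le> 3"
    using homogenization by blast
  have "real m * \<bar>h (lprod w) - 1\<bar> \<le> 3" for m
  proof -
    have "h (lprod w [^] int m) = of_int (int m) * h (lprod w)"
      using h(1) carr unfolding homogeneous_def by blast
    then have "h (lprod w [^] m) = real m * h (lprod w)"
      by (simp add: int_pow_int)
    moreover have "\<bar>counting_qm w (lprod w [^] m) - h (lprod w [^] m)\<bar> \<le> 3"
      using h(3) carr by simp
    ultimately have "\<bar>real m * (h (lprod w) - 1)\<bar> \<le> 3"
      using counting_qm_power[OF assms] by (simp add: algebra_simps abs_minus_commute)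
    then show ?thesis by (simp add: abs_mult)
  qed
  from multiples_bounded_imp_zero[OF this] h show ?thesis by (intro that[of h]) simp_all
qed

end


section \<open>The normal form theorem\<close>

text \<open>
  A choice of representatives for the right cosets of \<open>H\<close> that picks the identity for \<open>H\<close> itself.
\<close>

definition coset_rep :: "('x, 'm) monoid_scheme \<Rightarrow> 'x set \<Rightarrow> 'x \<Rightarrow> 'x" where
  "coset_rep X H x =
    (if \<one>\<^bsub>X\<^esub> \<in> H #>\<^bsub>X\<^esub> x then \<one>\<^bsub>X\<^esub> else SOME s. s \<in> H #>\<^bsub>X\<^esub> x)"

definition transversal :: "('x, 'm) monoid_scheme \<Rightarrow> 'x set \<Rightarrow> 'x set" where
  "transversal X H = {s \<in> carrier X - H. coset_rep X H s = s}"

text \<open>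
  One of the two factors and its view of the normal forms \<open>c s\<^sub>1 \<dots> s\<^sub>k\<close>, stored as the pair of
  \<open>c\<close> in \<open>C\<close> and the list of the \<open>s\<^sub>i\<close>, which are representatives from alternating factors. The
  factor sees only which letters are its own, so that the construction serves both factors.
\<close>

locale amalgam_factor = X: group X + C: group C
  for X :: "('x, 'm) monoid_scheme" and C :: "('c, 'k) monoid_scheme" +
  fixes f :: "'c \<Rightarrow> 'x" and \<iota> :: "'x \<Rightarrow> 's" and own :: "'s \<Rightarrow> bool" and normal :: "'s list \<Rightarrow> bool"
  assumes f_mon: "f \<in> mon C X" and \<iota>_inj: "inj \<iota>" and own_\<iota>: "own (\<iota> x)"
    and normal_own: "normal (l # ls) \<Longrightarrow> own l \<Longrightarrow>
      \<exists>s \<in> transversal X (f ` carrier C). l = \<iota> s"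
    and normal_tl: "normal (l # ls) \<Longrightarrow> normal ls"
    and normal_alternates: "normal (l # ls) \<Longrightarrow> own l \<Longrightarrow> ls \<noteq> [] \<Longrightarrow> \<not> own (hd ls)"
    and normal_Cons: "s \<in> transversal X (f ` carrier C) \<Longrightarrow> normal ls \<Longrightarrow>
      (ls \<noteq> [] \<Longrightarrow> \<not> own (hd ls)) \<Longrightarrow> normal (\<iota> s # ls)"
begin

abbreviation H where "H \<equiv> f ` carrier C"
abbreviation rep where "rep \<equiv> coset_rep X H"

definition c_part :: "'x \<Rightarrow> 'c" where
  "c_part x = the_inv_into (carrier C) f (x \<otimes>\<^bsub>X\<^esub> inv\<^bsub>X\<^esub> rep x)"

text \<open>
  Normal forms are in bijection, by \<open>split\<close> and \<open>join\<close>, with pairs of an element of \<open>X\<close> and a normal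
  form that does not begin with a letter of \<open>X\<close>: collect \<open>c\<close> and, if it is from \<open>X\<close>, the first
  representative. On such pairs \<open>X\<close> acts by multiplication on the first component, and the action on
  normal forms is transported along the bijection.
\<close>

definition states :: "('c \<times> 's list) set" where
  "states = {(c, ls). c \<in> carrier C \<and> normal ls}"

definition split_states :: "('x \<times> 's list) set" where
  "split_states = {(x, ls). x \<in> carrier X \<and> normal ls \<and> (ls \<noteq> [] \<longrightarrow> \<not> own (hd ls))}"

definition split :: "'c \<times> 's list \<Rightarrow> 'x \<times> 's list" where
  "split = (\<lambda>(c, ls). if ls \<noteq> [] \<and> own (hd ls)
     then (f c \<otimes>\<^bsub>X\<^esub> the_inv \<iota> (hd ls), tl ls) else (f c, ls))"

definition join :: "'x \<times> 's list \<Rightarrow> 'c \<times> 's list" where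
  "join = (\<lambda>(x, ls). (c_part x, if x \<in> H then ls else \<iota> (rep x) # ls))"

definition act :: "'x \<Rightarrow> 'c \<times> 's list \<Rightarrow> 'c \<times> 's list" where
  "act y st = join (y \<otimes>\<^bsub>X\<^esub> fst (split st), snd (split st))"

lemma f_closed [simp]: "c \<in> carrier C \<Longrightarrow> f c \<in> carrier X"
  and f_mult: "c \<in> carrier C \<Longrightarrow> d \<in> carrier C \<Longrightarrow> f (c \<otimes>\<^bsub>C\<^esub> d) = f c \<otimes>\<^bsub>X\<^esub> f d"
  and f_inj: "inj_on f (carrier C)"
  using f_mon by (auto simp: mon_def hom_def)

lemma f_one: "f \<one>\<^bsub>C\<^esub> = \<one>\<^bsub>X\<^esub>"
  using f_mon hom_one[of f C X] X.is_group C.is_group by (simp add: mon_def)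

lemma subgroup_H: "subgroup H X"
proof -
  interpret group_hom C X f
    using f_mon by unfold_locales (simp add: mon_def)
  show ?thesis by (rule img_is_subgroup)
qed

lemma one_in_coset_iff:
  assumes "x \<in> carrier X"
  shows "\<one>\<^bsub>X\<^esub> \<in> H #>\<^bsub>X\<^esub> x \<longleftrightarrow> x \<in> H"
proof
  assume "\<one>\<^bsub>X\<^esub> \<in> H #>\<^bsub>X\<^esub> x"
  from X.repr_independence[OF this assms subgroup_H]
  have "H #>\<^bsub>X\<^esub> x = H" using X.coset_mult_one[of H] subgroup.subset[OF subgroup_H] by simp
  then show "x \<in> H" using X.rcos_self[OF assms subgroup_H] by simp
next
  assume "x \<in> H"
  from X.coset_join2[OF assms subgroup_H this] show "\<one>\<^bsub>X\<^esub> \<in> H #>\<^bsub>X\<^esub> x"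
    using subgroup.one_closed[OF subgroup_H] by simp
qed

lemma rep_in_coset:
  assumes "x \<in> carrier X"
  shows "rep x \<in> H #>\<^bsub>X\<^esub> x"
  using X.rcos_self[OF assms subgroup_H] by (auto simp: coset_rep_def intro: someI)

lemma rep_closed [simp]: "x \<in> carrier X \<Longrightarrow> rep x \<in> carrier X"
  using rep_in_coset X.r_coset_subset_G[OF subgroup.subset[OF subgroup_H]] by blast

lemma rep_in_H: "x \<in> H \<Longrightarrow> rep x = \<one>\<^bsub>X\<^esub>"
  using one_in_coset_iff[of x] by (auto simp: coset_rep_def)

lemma rep_eq:
  assumes "x \<in> carrier X" "y \<in> H #>\<^bsub>X\<^esub> x"
  shows "rep y = rep x"
  using X.repr_independence[OF assms(2,1) subgroup_H] by (simp add: coset_rep_def)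

lemma rep_f_mult:
  assumes "c \<in> carrier C" "x \<in> carrier X"
  shows "rep (f c \<otimes>\<^bsub>X\<^esub> x) = rep x"
  by (rule rep_eq) (use assms in \<open>auto simp: r_coset_def\<close>)

lemma rep_transversal:
  assumes "x \<in> carrier X" "x \<notin> H"
  shows "rep x \<in> transversal X H"
proof -
  have "rep x \<notin> H"
  proof
    assume "rep x \<in> H"
    then have "H #>\<^bsub>X\<^esub> x = H"
      using X.repr_independence[OF rep_in_coset[OF assms(1)] assms(1) subgroup_H]
        X.coset_join2[OF rep_closed[OF assms(1)] subgroup_H] by simp
    then show False using X.rcos_self[OF assms(1) subgroup_H] assms by simp
  qed
  then show ?thesis
    using rep_eq[OF assms(1) rep_in_coset[OF assms(1)]] assms by (simp add: transversal_def)
qed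

lemma decompose:
  assumes x: "x \<in> carrier X"
  shows "c_part x \<in> carrier C" and "f (c_part x) \<otimes>\<^bsub>X\<^esub> rep x = x"
proof -
  have "H #>\<^bsub>X\<^esub> x = H #>\<^bsub>X\<^esub> rep x"
    using X.repr_independence[OF rep_in_coset[OF x] x subgroup_H] .
  then have "x \<in> H #>\<^bsub>X\<^esub> rep x"
    using X.rcos_self[OF x subgroup_H] by simp
  then obtain c where c: "c \<in> carrier C" "x = f c \<otimes>\<^bsub>X\<^esub> rep x"
    by (auto simp: r_coset_def)
  have "x \<otimes>\<^bsub>X\<^esub> inv\<^bsub>X\<^esub> rep x = f c \<otimes>\<^bsub>X\<^esub> rep x \<otimes>\<^bsub>X\<^esub> inv\<^bsub>X\<^esub> rep x"
    using c(2) by simp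
  also have "\<dots> = f c"
    using c(1) x by (simp add: X.m_assoc)
  finally have "c_part x = c"
    using c(1) by (simp add: c_part_def the_inv_into_f_f[OF f_inj])
  with c show "c_part x \<in> carrier C" "f (c_part x) \<otimes>\<^bsub>X\<^esub> rep x = x"
    by simp_all
qed

lemma c_part_eq:
  assumes "c \<in> carrier C" "s \<in> carrier X" "rep s = s"
  shows "c_part (f c \<otimes>\<^bsub>X\<^esub> s) = c"
proof -
  let ?x = "f c \<otimes>\<^bsub>X\<^esub> s"
  have x: "?x \<in> carrier X" using assms by simp
  have "f (c_part ?x) \<otimes>\<^bsub>X\<^esub> s = f c \<otimes>\<^bsub>X\<^esub> s"
    using decompose(2)[OF x] rep_f_mult[OF assms(1,2)] assms(3) by simp
  then have "f (c_part ?x) = f c"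
    using assms decompose(1)[OF x] by simp
  then show ?thesis
    using f_inj decompose(1)[OF x] assms(1) by (simp add: inj_on_def)
qed

lemma f_mult_in_H_iff:
  assumes "c \<in> carrier C" "x \<in> carrier X"
  shows "f c \<otimes>\<^bsub>X\<^esub> x \<in> H \<longleftrightarrow> x \<in> H"
proof -
  have "H #>\<^bsub>X\<^esub> (f c \<otimes>\<^bsub>X\<^esub> x) = H #>\<^bsub>X\<^esub> x"
    by (rule X.repr_independence[symmetric]) (use assms subgroup_H in \<open>auto simp: r_coset_def\<close>)
  then show ?thesis
    using one_in_coset_iff[of "f c \<otimes>\<^bsub>X\<^esub> x"] one_in_coset_iff[of x] assms by simp
qed

lemma split_Cons_own:
  "split (c, \<iota> s # ls) = (f c \<otimes>\<^bsub>X\<^esub> s, ls)"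
  by (simp add: split_def own_\<iota> the_inv_f_f[OF \<iota>_inj])

lemma split_other:
  "(ls \<noteq> [] \<longrightarrow> \<not> own (hd ls)) \<Longrightarrow> split (c, ls) = (f c, ls)"
  by (auto simp: split_def)

lemma states_cases:
  assumes "st \<in> states"
  obtains (own) c s ls where "st = (c, \<iota> s # ls)" "c \<in> carrier C" "s \<in> transversal X H"
      "normal ls" "ls \<noteq> [] \<longrightarrow> \<not> own (hd ls)"
    | (other) c ls where "st = (c, ls)" "c \<in> carrier C" "normal ls" "ls \<noteq> [] \<longrightarrow> \<not> own (hd ls)"
proof -
  obtain c ls where st: "st = (c, ls)" "c \<in> carrier C" "normal ls"
    using assms by (auto simp: states_def)
  show ?thesis
  proof (cases "ls \<noteq> [] \<and> own (hd ls)")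
    case True
    then obtain l ls' where ls: "ls = l # ls'" "own l" by (cases ls) auto
    then obtain s where "s \<in> transversal X H" "l = \<iota> s"
      using normal_own st by blast
    then show ?thesis
      using own[of c s ls'] st ls normal_tl[of l ls'] normal_alternates[of l ls'] by simp
  qed (use other st in blast)
qed

lemma split_closed: "st \<in> states \<Longrightarrow> split st \<in> split_states"
  by (erule states_cases)
    (auto simp: split_Cons_own split_other split_states_def transversal_def)

lemma join_closed: "p \<in> split_states \<Longrightarrow> join p \<in> states"
  by (auto simp: split_states_def states_def join_def decompose intro!: normal_Cons rep_transversal)

lemma split_join:
  assumes "p \<in> split_states"
  shows "split (join p) = p"
proof -
  obtain x ls where p: "p = (x, ls)" "x \<in> carrier X" "ls \<noteq> [] \<longrightarrow> \<not> own (hd ls)"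
    using assms by (auto simp: split_states_def)
  note x = decompose[OF p(2)]
  show ?thesis
  proof (cases "x \<in> H")
    case True
    then have "f (c_part x) = x"
      using x rep_in_H by simp
    with True p show ?thesis by (simp add: join_def split_other)
  next
    case False
    with x p show ?thesis by (simp add: join_def split_Cons_own)
  qed
qed

lemma join_split:
  assumes "st \<in> states"
  shows "join (split st) = st"
  using assms
proof (cases rule: states_cases)
  case (own c s ls)
  then have s: "s \<in> carrier X" "rep s = s" "s \<notin> H"
    by (auto simp: transversal_def)
  then show ?thesis
    using own c_part_eq[of c s] rep_f_mult[of c s] f_mult_in_H_iff[of c s]
    by (simp add: split_Cons_own join_def)
next
  case (other c ls)
  have "rep \<one>\<^bsub>X\<^esub> = \<one>\<^bsub>X\<^esub>"
    by (intro rep_in_H subgroup.one_closed[OF subgroup_H])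
  then show ?thesis
    using other c_part_eq[of c "\<one>\<^bsub>X\<^esub>"] by (simp add: split_other join_def)
qed

lemma act_arg_closed:
  assumes "y \<in> carrier X" "st \<in> states"
  shows "(y \<otimes>\<^bsub>X\<^esub> fst (split st), snd (split st)) \<in> split_states"
  using split_closed[OF assms(2)] assms(1) by (auto simp: split_states_def)

lemma act_closed: "y \<in> carrier X \<Longrightarrow> st \<in> states \<Longrightarrow> act y st \<in> states"
  unfolding act_def by (intro join_closed act_arg_closed)

lemma act_mult:
  assumes "x \<in> carrier X" "y \<in> carrier X" "st \<in> states"
  shows "act x (act y st) = act (x \<otimes>\<^bsub>X\<^esub> y) st"
proof -
  have "fst (split st) \<in> carrier X"
    using split_closed[OF assms(3)] by (auto simp: split_states_def)
  then show ?thesis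
    using split_join[OF act_arg_closed[OF assms(2,3)]] assms
    by (simp add: act_def[of y] act_def[of x] act_def[of "x \<otimes>\<^bsub>X\<^esub> y"] X.m_assoc)
qed

text \<open>
  The action of \<open>C\<close> changes only the \<open>C\<close>-component, by a formula in which \<open>f\<close> does not occur. Hence
  the actions of the two factors agree on \<open>C\<close>.
\<close>

lemma act_f:
  assumes "d \<in> carrier C" "(c, ls) \<in> states"
  shows "act (f d) (c, ls) = (d \<otimes>\<^bsub>C\<^esub> c, ls)"
proof -
  have st: "(d \<otimes>\<^bsub>C\<^esub> c, ls) \<in> states"
    using assms by (auto simp: states_def)
  have "(f d \<otimes>\<^bsub>X\<^esub> fst (split (c, ls)), snd (split (c, ls))) = split (d \<otimes>\<^bsub>C\<^esub> c, ls)"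
    using assms(2)
    by (cases rule: states_cases)
      (use assms(1) in \<open>auto simp: split_Cons_own split_other f_mult X.m_assoc transversal_def\<close>)
  then show ?thesis
    unfolding act_def using join_split[OF st] by simp
qed

lemma act_one: "st \<in> states \<Longrightarrow> act \<one>\<^bsub>X\<^esub> st = st"
  using act_f[of "\<one>\<^bsub>C\<^esub>" "fst st" "snd st"] by (auto simp: f_one states_def)

text \<open>
  Such a letter lengthens the normal form, for the representative of a coset other than \<open>H\<close> is not
  dropped.
\<close>

lemma act_push:
  assumes "y \<in> carrier X" "y \<notin> H" "(c, ls) \<in> states" "ls \<noteq> [] \<longrightarrow> \<not> own (hd ls)"
  obtains c' s where "act y (c, ls) = (c', \<iota> s # ls)"
proof -
  have "c \<in> carrier C" using assms(3) by (auto simp: states_def)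
  then have "y \<otimes>\<^bsub>X\<^esub> f c \<notin> H"
  proof -
    assume c: "c \<in> carrier C"
    have "y = y \<otimes>\<^bsub>X\<^esub> f c \<otimes>\<^bsub>X\<^esub> inv\<^bsub>X\<^esub> f c"
      using assms(1) c by (simp add: X.m_assoc)
    then show ?thesis
      using assms(2) c subgroup.m_closed[OF subgroup_H] subgroup.m_inv_closed[OF subgroup_H]
      by (metis imageI)
  qed
  then show ?thesis
    using assms(4) by (intro that[of "c_part (y \<otimes>\<^bsub>X\<^esub> f c)"]) (simp add: act_def split_other join_def)
qed

end

context amalgamation
begin

definition normal :: "('a + 'b) list \<Rightarrow> bool" where
  "normal ls \<longleftrightarrow>
     set ls \<subseteq> transversal A (i ` carrier C) <+> transversal B (j ` carrier C) \<and>
     successively (\<lambda>x y. isl x \<noteq> isl y) ls"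

sublocale left: amalgam_factor A C i Inl isl normal
  by unfold_locales (auto simp: i_mon normal_def successively_Cons)

sublocale right: amalgam_factor B C j Inr "\<lambda>l. \<not> isl l" normal
  by unfold_locales (auto simp: j_mon normal_def successively_Cons)

definition act_word :: "('a + 'b) list \<Rightarrow> 'c \<times> ('a + 'b) list \<Rightarrow> 'c \<times> ('a + 'b) list" where
  "act_word = foldr (case_sum left.act right.act)"

lemma act_word_simps [simp]:
  "act_word [] st = st" "act_word (Inl x # u) st = left.act x (act_word u st)"
  "act_word (Inr y # u) st = right.act y (act_word u st)"
  "act_word (u @ v) st = act_word u (act_word v st)"
  by (simp_all add: act_word_def)

lemma act_word_closed: "u \<in> words A B \<Longrightarrow> st \<in> left.states \<Longrightarrow> act_word u st \<in> left.states"
proof (induction u)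
  case (Cons s u)
  then show ?case
    using left.act_closed right.act_closed by (cases s) auto
qed simp

lemma act_word_equiv: "u \<approx> v \<Longrightarrow> st \<in> left.states \<Longrightarrow> act_word u st = act_word v st"
proof (induction arbitrary: st rule: amalg_equiv.induct)
  case (append u u' v v')
  then show ?case using act_word_closed equiv_words[OF append.hyps(2)] by simp
next
  case (glue c)
  obtain d ls where st: "st = (d, ls)" by (cases st)
  have "left.act (i c) (d, ls) = (c \<otimes>\<^bsub>C\<^esub> d, ls)"
    by (rule left.act_f) (use glue st in simp_all)
  moreover have "right.act (j c) (d, ls) = (c \<otimes>\<^bsub>C\<^esub> d, ls)"
    by (rule right.act_f) (use glue st in simp_all)
  ultimately show ?case by (simp add: st)
next
  case (trans u v w)
  then show ?case by metis
qed (simp_all add: left.act_mult right.act_mult left.act_one right.act_one)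

lemma reduced_word_Cons:
  "reduced_word A B C i j (s # u) \<longleftrightarrow>
     s \<in> (carrier A - i ` carrier C) <+> (carrier B - j ` carrier C) \<and>
     reduced_word A B C i j u \<and> (u \<noteq> [] \<longrightarrow> isl s \<noteq> isl (hd u))"
  by (auto simp: reduced_word_def successively_Cons)

lemma reduced_word_words: "reduced_word A B C i j u \<Longrightarrow> u \<in> words A B"
  by (auto simp: reduced_word_def words_def)

lemma act_word_reduced:
  assumes "reduced_word A B C i j u"
  shows "map isl (snd (act_word u (\<one>\<^bsub>C\<^esub>, []))) = map isl u"
  using assms
proof (induction u)
  case (Cons s u)
  obtain c ls where st: "act_word u (\<one>\<^bsub>C\<^esub>, []) = (c, ls)"
    by (cases "act_word u (\<one>\<^bsub>C\<^esub>, [])")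
  have "u \<in> words A B"
    using Cons.prems reduced_word_words by (simp add: reduced_word_Cons)
  then have mem: "(c, ls) \<in> left.states"
    using act_word_closed[of u "(\<one>\<^bsub>C\<^esub>, [])"] st by (simp add: left.states_def normal_def)
  have IH: "map isl ls = map isl u"
    using Cons st by (simp add: reduced_word_Cons)
  then have hd: "ls \<noteq> [] \<longrightarrow> isl (hd ls) \<noteq> isl s"
    using Cons.prems by (cases ls; cases u) (auto simp: reduced_word_Cons)
  show ?case
  proof (cases s)
    case (Inl x)
    then obtain c' s' where "left.act x (c, ls) = (c', Inl s' # ls)"
      using left.act_push[of x c ls] Cons.prems mem hd by (auto simp: reduced_word_Cons)
    then show ?thesis using st Inl IH by simp
  next
    case (Inr x)
    then obtain c' s' where "right.act x (c, ls) = (c', Inr s' # ls)"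
      using right.act_push[of x c ls] Cons.prems mem hd
      by (auto simp: reduced_word_Cons)
    then show ?thesis using st Inr IH by simp
  qed
qed simp

text \<open>
  A reduced word takes the empty normal form to a normal form of its own length, whereas an element
  of \<open>C\<close> leaves the list empty.
\<close>

theorem reduced_word_not_base:
  assumes "reduced_word A B C i j u" "u \<noteq> []"
  shows "elem u \<notin> amalg_base A B C i j"
proof
  assume "elem u \<in> amalg_base A B C i j"
  then obtain c where c: "c \<in> carrier C" "u \<approx> [Inl (i c)]"
    using elem_eq_iff[OF reduced_word_words[OF assms(1)]] by (auto simp: amalg_base_def)
  have st: "(\<one>\<^bsub>C\<^esub>, []) \<in> left.states" by (simp add: left.states_def normal_def)
  have "act_word u (\<one>\<^bsub>C\<^esub>, []) = (c \<otimes>\<^bsub>C\<^esub> \<one>\<^bsub>C\<^esub>, [])"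
    using act_word_equiv[OF c(2) st] left.act_f[OF c(1) st] by simp
  with act_word_reduced[OF assms(1)] assms(2) show False by simp
qed

end


section \<open>The amalgamated free product as an amalgam of subgroups\<close>

context amalgamation
begin

abbreviation letter :: "'a + 'b \<Rightarrow> ('a + 'b) list set" where "letter s \<equiv> elem [s]"
abbreviation A_image where "A_image \<equiv> (\<lambda>x. letter (Inl x)) ` carrier A"
abbreviation B_image where "B_image \<equiv> (\<lambda>y. letter (Inr y)) ` carrier B"

lemma equiv_elem_eq: "u \<approx> v \<Longrightarrow> elem u = elem v"
  using elem_eq_iff equiv_words by blast

lemma elem_closed [simp]: "u \<in> words A B \<Longrightarrow> elem u \<in> carrier G"
  by (simp add: carrier_G)

lemma subgroup_A_image: "subgroup A_image G"
proof -
  have "(\<lambda>x. letter (Inl x)) \<in> hom A G"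
    using equiv_elem_eq[OF amalg_equiv.mult_left] by (auto simp: hom_def mult_elem)
  then interpret group_hom A G "\<lambda>x. letter (Inl x)"
    using group_G A.is_group by (simp add: group_hom_def group_hom_axioms_def)
  show ?thesis by (rule img_is_subgroup)
qed

lemma subgroup_B_image: "subgroup B_image G"
proof -
  have "(\<lambda>x. letter (Inr x)) \<in> hom B G"
    using equiv_elem_eq[OF amalg_equiv.mult_right] by (auto simp: hom_def mult_elem)
  then interpret group_hom B G "\<lambda>x. letter (Inr x)"
    using group_G B.is_group by (simp add: group_hom_def group_hom_axioms_def)
  show ?thesis by (rule img_is_subgroup)
qed

lemma lprod_letters: "u \<in> words A B \<Longrightarrow> monoid.lprod G (map letter u) = elem u"
proof (induction u)
  case Nil
  then show ?case
    using group.is_monoid[OF group_G] by (simp add: monoid.lprod_def one_G)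
next
  case (Cons s u)
  then have "[s] \<in> words A B" "u \<in> words A B"
    by (auto simp: words_def)
  then show ?case
    using Cons.IH mult_elem[of "[s]" u] group.is_monoid[OF group_G] by (simp add: monoid.lprod_def)
qed

text \<open>
  If \<open>x\<close> in \<open>A\<close> and \<open>y\<close> in \<open>B\<close> define the same element and neither comes from \<open>C\<close>, then
  \<open>x\<inverse> y\<close> is a reduced word for the identity, against the normal form theorem.
\<close>

lemma images_Int: "A_image \<inter> B_image = amalg_base A B C i j"
proof
  show "amalg_base A B C i j \<subseteq> A_image \<inter> B_image"
  proof
    fix g
    assume "g \<in> amalg_base A B C i j"
    then obtain c where c: "c \<in> carrier C" "g = letter (Inl (i c))"
      by (auto simp: amalg_base_def)
    moreover have "letter (Inl (i c)) = letter (Inr (j c))"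
      using c by (intro equiv_elem_eq amalg_equiv.glue)
    moreover have "letter (Inl (i c)) \<in> A_image" "letter (Inr (j c)) \<in> B_image"
      using c(1) by (intro imageI; simp)+
    ultimately show "g \<in> A_image \<inter> B_image"
      by simp
  qed
  show "A_image \<inter> B_image \<subseteq> amalg_base A B C i j"
  proof
    fix g
    assume "g \<in> A_image \<inter> B_image"
    then obtain x y where x: "x \<in> carrier A" "g = letter (Inl x)"
      and y: "y \<in> carrier B" "g = letter (Inr y)" by auto
    show "g \<in> amalg_base A B C i j"
    proof (rule ccontr)
      assume notin: "g \<notin> amalg_base A B C i j"
      have "x \<notin> i ` carrier C"
        using notin x(2) by (auto simp: amalg_base_def)
      moreover have "inv\<^bsub>A\<^esub> x \<in> i ` carrier C \<Longrightarrow> x \<in> i ` carrier C"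
        using subgroup.m_inv_closed[OF left.subgroup_H] A.inv_inv[OF x(1)] by metis
      moreover have "y \<notin> j ` carrier C"
      proof
        assume "y \<in> j ` carrier C"
        then obtain c where c: "c \<in> carrier C" "y = j c" by blast
        then have "g = letter (Inl (i c))"
          using y equiv_elem_eq[OF amalg_equiv.glue[OF c(1)]] by metis
        with notin c show False by (auto simp: amalg_base_def)
      qed
      ultimately have "reduced_word A B C i j [Inl (inv\<^bsub>A\<^esub> x), Inr y]"
        using x y by (auto simp: reduced_word_def)
      then have "elem [Inl (inv\<^bsub>A\<^esub> x), Inr y] \<notin> amalg_base A B C i j"
        by (rule reduced_word_not_base) simp
      moreover have "elem [Inl (inv\<^bsub>A\<^esub> x), Inr y] = elem [Inl (inv\<^bsub>A\<^esub> x), Inl x]"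
        using mult_elem[of "[Inl (inv\<^bsub>A\<^esub> x)]" "[Inr y]"] mult_elem[of "[Inl (inv\<^bsub>A\<^esub> x)]" "[Inl x]"] x y
        by simp
      moreover have "elem [Inl (inv\<^bsub>A\<^esub> x), Inl x] = letter (Inl (i \<one>\<^bsub>C\<^esub>))"
        using equiv_elem_eq[OF amalg_equiv.mult_left[of "inv\<^bsub>A\<^esub> x" A x B C i j]] x
        by (simp add: left.f_one)
      ultimately show False by (auto simp: amalg_base_def)
    qed
  qed
qed

lemma reduced_letter:
  assumes "s \<in> (carrier A - i ` carrier C) <+> (carrier B - j ` carrier C)"
  shows "letter s \<in> A_image \<union> B_image - A_image \<inter> B_image" and "letter s \<in> A_image \<longleftrightarrow> isl s"
proof -
  have "reduced_word A B C i j [s]"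
    using assms by (simp add: reduced_word_def)
  then have "letter s \<notin> A_image \<inter> B_image"
    unfolding images_Int by (rule reduced_word_not_base) simp
  moreover have "isl s \<Longrightarrow> letter s \<in> A_image" "\<not> isl s \<Longrightarrow> letter s \<in> B_image"
    using assms by auto
  ultimately show "letter s \<in> A_image \<union> B_image - A_image \<inter> B_image" "letter s \<in> A_image \<longleftrightarrow> isl s"
    by blast+
qed

lemma reduced_letters:
  "reduced_word A B C i j u \<Longrightarrow> reduced_list A_image B_image (map letter u)"
proof (induction u)
  case (Cons s u)
  then have s: "s \<in> (carrier A - i ` carrier C) <+> (carrier B - j ` carrier C)"
    and u: "reduced_word A B C i j u" "u \<noteq> [] \<longrightarrow> isl s \<noteq> isl (hd u)"
    by (simp_all add: reduced_word_Cons)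
  have "(letter s \<in> A_image) \<noteq> (hd (map letter u) \<in> A_image)" if "u \<noteq> []"
    using that u reduced_letter(2)[OF s] reduced_letter(2)[of "hd u"]
    by (cases u) (auto simp: reduced_word_Cons)
  then show ?case
    using Cons.IH[OF u(1)] reduced_letter(1)[OF s] by simp
qed simp

text \<open>
  An element outside \<open>C\<close> of the image of a factor may be represented only by letters outside the
  image of \<open>C\<close>, so any choice of letters gives a reduced word.
\<close>

lemma reduced_list_lift:
  assumes "reduced_list A_image B_image xs"
  shows "\<exists>u. reduced_word A B C i j u \<and> xs = map letter u"
  using assms
proof (induction xs)
  case Nil
  then show ?case by (auto simp: reduced_word_def)
next
  case (Cons g xs)
  then obtain u where u: "reduced_word A B C i j u" "xs = map letter u" by auto
  have g: "g \<in> A_image \<union> B_image - A_image \<inter> B_image" using Cons.prems by simp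
  obtain s where s: "s \<in> (carrier A - i ` carrier C) <+> (carrier B - j ` carrier C)" "g = letter s"
  proof -
    obtain s where s: "s \<in> carrier A <+> carrier B" "g = letter s" using g by blast
    have "g \<notin> amalg_base A B C i j" using g images_Int by blast
    then have "s \<noteq> Inl (i c)" "s \<noteq> Inr (j c)" if "c \<in> carrier C" for c
      using that s(2) equiv_elem_eq[OF amalg_equiv.glue[OF that]] by (auto simp: amalg_base_def)
    then show ?thesis using s that by (cases s) auto
  qed
  have "isl s \<noteq> isl (hd u)" if "u \<noteq> []"
  proof -
    obtain t u' where t: "u = t # u'" using \<open>u \<noteq> []\<close> by (cases u) auto
    then show ?thesis
      using Cons.prems u s reduced_letter(2)[OF s(1)] reduced_letter(2)[of t]
      by (simp add: reduced_word_Cons)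
  qed
  then have "reduced_word A B C i j (s # u)" using s u by (simp add: reduced_word_Cons)
  then show ?case using s u by (intro exI[of _ "s # u"]) simp
qed

sublocale amalg: amalgamated_subgroups G A_image B_image
proof (intro amalgamated_subgroups.intro amalgamated_subgroups_axioms.intro
    group_G subgroup_A_image subgroup_B_image)
  fix g
  assume "g \<in> carrier G"
  then obtain u where u: "u \<in> words A B" "g = elem u" by (auto simp: carrier_G)
  then have "set (map letter u) \<subseteq> A_image \<union> B_image" by (auto simp: words_def)
  then show "\<exists>xs. set xs \<subseteq> A_image \<union> B_image \<and> g = monoid.lprod G xs"
    using u lprod_letters by metis
next
  fix xs
  assume "reduced_list A_image B_image xs" "xs \<noteq> []"
  then obtain u where u: "reduced_word A B C i j u" "xs = map letter u" "u \<noteq> []"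
    using reduced_list_lift by blast
  then show "monoid.lprod G xs \<notin> A_image \<inter> B_image"
    using reduced_word_not_base lprod_letters[OF reduced_word_words[OF u(1)]] images_Int by simp
qed

lemma inv_elem:
  assumes "u \<in> words A B"
  shows "inv\<^bsub>G\<^esub> elem u = elem (inverse_word A B u)"
proof (rule amalg.inv_equality)
  show "elem (inverse_word A B u) \<otimes>\<^bsub>G\<^esub> elem u = \<one>\<^bsub>G\<^esub>"
    using assms equiv_elem_eq[OF inverse_word_cancel[OF assms]]
    by (simp add: mult_elem inverse_word_closed one_G)
qed (use assms inverse_word_closed in simp_all)

lemma coset_equiv_double_coset:
  assumes "amalg.coset_equiv g h"
  shows "g \<in> double_coset G (amalg_base A B C i j) h"
proof -
  obtain c d where cd: "c \<in> A_image \<inter> B_image" "d \<in> A_image \<inter> B_image" "g \<otimes>\<^bsub>G\<^esub> d = c \<otimes>\<^bsub>G\<^esub> h"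
    and carr: "g \<in> carrier G" "h \<in> carrier G"
    using assms unfolding amalg.coset_equiv_def by blast
  have base: "subgroup (A_image \<inter> B_image) G"
    by (rule amalg.subgroups_Inter_pair[OF subgroup_A_image subgroup_B_image])
  have "inv\<^bsub>G\<^esub> d \<in> A_image \<inter> B_image" "d \<in> carrier G"
    by (rule subgroup.m_inv_closed[OF base cd(2)], rule subgroup.mem_carrier[OF base cd(2)])
  moreover from this have "g = c \<otimes>\<^bsub>G\<^esub> h \<otimes>\<^bsub>G\<^esub> inv\<^bsub>G\<^esub> d"
    using carr by (simp add: amalg.m_assoc flip: cd(3))
  ultimately show ?thesis
    using cd(1) unfolding double_coset_def images_Int by blast
qed

end

lemma rev_rotate: "\<exists>k. rev (rotate n xs) = rotate k (rev xs)"
proof (cases "xs = [] \<or> n mod length xs = 0")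
  case True
  then have "rev (rotate n xs) = rotate 0 (rev xs)"
    by (subst rotate_conv_mod) auto
  then show ?thesis ..
next
  case False
  define m where "m = n mod length xs"
  have m: "0 < m" "m < length xs" using False by (auto simp: m_def)
  then have "rotate (length xs - m) (rev xs) = rev (rotate m xs)"
    by (subst rotate_rev) simp
  moreover have "rotate n xs = rotate m xs"
    unfolding m_def by (rule rotate_conv_mod)
  ultimately show ?thesis by metis
qed

lemma inverse_word_rotate:
  "inverse_word A B (rotate n w) \<in> cyclic_conjugates (inverse_word A B w)"
  using rev_rotate[of n "map (map_sum (m_inv A) (m_inv B)) w"]
  by (auto simp: inverse_word_def cyclic_conjugates_def rotate_map)

lemma rotate_in_words: "w \<in> words A B \<Longrightarrow> rotate n w \<in> words A B"
  by (auto simp: words_def in_lists_conv_set)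

text \<open>
  The junction of two copies of \<open>w\<close> is the last junction of the cyclic conjugate that moves the first
  letter to the end.
\<close>

lemma cyclically_reduced_imp_reduced_square:
  assumes "cyclically_reduced A B C i j w" "length w > 1"
  shows "reduced_word A B C i j (w @ w)"
proof -
  obtain s u where w: "w = s # u" "u \<noteq> []"
    using assms(2) by (cases w) auto
  have "rotate 0 w \<in> cyclic_conjugates w" "rotate 1 w \<in> cyclic_conjugates w"
    unfolding cyclic_conjugates_def by blast+
  then have "reduced_word A B C i j w" "reduced_word A B C i j (u @ [s])"
    using assms(1) w by (auto simp: cyclically_reduced_def)
  then show ?thesis
    using w by (auto simp: reduced_word_def successively_append_iff successively_Cons)
qed

theorem theoremD:
  fixes A :: "('a, 'm) monoid_scheme" and B :: "('b, 'n) monoid_scheme"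
    and C :: "('c, 'k) monoid_scheme"
    and i :: "'c \<Rightarrow> 'a" and j :: "'c \<Rightarrow> 'b"
    and G :: "('a + 'b) list set monoid" and w :: "('a + 'b) list"
  assumes "group A" and "group B" and "group C"
    and "i \<in> mon C A" and "j \<in> mon C B"
    and "G = amalg A B C i j"
    and "w \<in> words A B" and "length w > 1"
    and "reduced_word A B C i j w" and "cyclically_reduced A B C i j w"
    and "\<forall>u \<in> cyclic_conjugates (inverse_word A B w).
           word_elem A B C i j u \<notin> double_coset G (amalg_base A B C i j) (word_elem A B C i j w)"
  shows "\<exists>h :: ('a + 'b) list set \<Rightarrow> real.
           quasimorphism G h \<and> homogeneous G h \<and>
           h (word_elem A B C i j w) = 1 \<and> defect G h \<le> 312"
proof -
  interpret amalgamation A B C i j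
    using assms(1-5) by (intro amalgamation.intro amalgamation_axioms.intro)
  let ?w = "map letter w"
  have "reduced_list A_image B_image (?w @ ?w)"
    using reduced_letters[OF cyclically_reduced_imp_reduced_square[OF assms(10,8)]] by simp
  moreover have "?w \<noteq> []" using assms(8) by auto
  moreover have "\<not> amalg.coset_equiv (amalg.lprod (rotate n ?w)) (inv\<^bsub>amalg A B C i j\<^esub> amalg.lprod ?w)" for n
  proof
    let ?u = "rotate n w"
    assume "amalg.coset_equiv (amalg.lprod (rotate n ?w)) (inv\<^bsub>amalg A B C i j\<^esub> amalg.lprod ?w)"
    then have "amalg.coset_equiv (elem ?u) (inv\<^bsub>amalg A B C i j\<^esub> elem w)"
      using assms(7) by (simp add: rotate_map lprod_letters rotate_in_words)
    from amalg.coset_equiv_inv[OF this]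
    have "amalg.coset_equiv (elem (inverse_word A B ?u)) (elem w)"
      using assms(7) inv_elem[OF rotate_in_words[OF assms(7)]] by simp
    then show False
      using coset_equiv_double_coset assms(11) inverse_word_rotate unfolding assms(6) by blast
  qed
  ultimately obtain h where h: "homogeneous (amalg A B C i j) h"
    "defect_bound (amalg A B C i j) h 12" "h (amalg.lprod ?w) = 1"
    using amalg.homogeneous_quasimorphism_detecting by blast
  then have "defect G h \<le> 12" "quasimorphism G h"
    using defect_least unfolding assms(6) quasimorphism_def by blast+
  then show ?thesis
    using h assms(7) by (intro exI[of _ h]) (simp add: assms(6) lprod_letters)
qed

end
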